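(* Let $P(\lambda):=\lambda^2M+\lambda D+K$, where $0<M=M^*\in\mathbb C^{n\times n}$, $0\le D=D^*\in\mathbb C^{n\times n}$ and $0\le K=K^*\in\mathbb C^{n\times n}$, and let $P_0(\lambda):=\lambda^2M+K$. Let $\omega\in\mathbb R$ be nonzero. (a) Then $i\omega\in\Lambda(P)$ if and only if $\operatorname{rank}\begin{bmatrix}P_0(i\omega)&D\end{bmatrix}<n$. If $i\omega\in\Lambda(P)$, then $i\omega\in\Lambda(P_0)$ and $\mathcal N(P(i\omega))=\mathcal N(P_0(i\omega))\cap\mathcal N(D)$. (b) Suppose that $i\omega\in\Lambda(P)$ and $\operatorname{rank}\begin{bmatrix}P_0(i\omega)&D\end{bmatrix}=n-p$. Then the geometric multiplicity of $i\omega$ (as an eigenvalue of $P$) is $p$. Consider a QR factorization $$Q^*\begin{bmatrix}P_0(i\omega)&D\end{bmatrix}=\begin{bmatrix}R\\0_{p\times 2n}\end{bmatrix},$$ where $R$ has full row rank and $Q=\begin{bmatrix}Q_1&Q_2\end{bmatrix}$ is unitary with $Q_2\in\mathbb C^{n\times p}$. Then the columns of $Q_2$ span $\mathcal N(P(i\omega))$. Define $X_2:=Q_2(Q_2^*MQ_2)^{-1/2}$ and consider a QR factorization $$Y^*(MX_2)=\begin{bmatrix}R_1\\0_{(n-p)\times p}\end{bmatrix},$$ where $Y=\begin{bmatrix}Y_1&Y_2\end{bmatrix}$ is unitary and $Y_2\in\mathbb C^{n\times(n-p)}$. Set $X_1:=Y_2(Y_2^*MY_2)^{-1/2}$ and $X:=\begin{bmatrix}X_1&X_2\end{bmatrix}$.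 Then $X$ is $M$-unitary and $$X^*P(\lambda)X=\operatorname{diag}\big(\widetilde P(\lambda),\ (\lambda^2+\omega^2)I_p\big),$$ where $\widetilde P(\lambda):=X_1^*P(\lambda)X_1$, and $\Lambda(\widetilde P)=\Lambda(P)\setminus\{\pm i\omega\}$.
   Context: $A^*$ denotes the conjugate transpose; for Hermitian matrices $X>0$ ($X\ge0$) means positive (semi)definite. $\mathcal N(X)$ is the nullspace of $X$. For a square matrix polynomial $R(\lambda)$ with $\det R\not\equiv0$, $\Lambda(R):=\{\lambda\in\mathbb C:\det R(\lambda)=0\}$, and the geometric multiplicity of $\mu\in\Lambda(R)$ is $\dim\mathcal N(R(\mu))$. A matrix $X\in\mathbb C^{n\times n}$ is $M$-unitary if $X^*MX=I_n$. For a positive definite matrix $B$, $B^{-1/2}$ is the inverse of its positive definite square root. *)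

theory Defs
  imports
    "Jordan_Normal_Form.Schur_Decomposition"
    "Jordan_Normal_Form.DL_Rank"
    "Jordan_Normal_Form.Matrix_Kernel"
    "Jordan_Normal_Form.Gauss_Jordan_Elimination"
begin

definition append_cols :: "complex mat \<Rightarrow> complex mat \<Rightarrow> complex mat"  (infixr \<open>@\<^sub>c\<close> 65)
  where "A @\<^sub>c B = four_block_mat A B (0\<^sub>m 0 (dim_col A)) (0\<^sub>m 0 (dim_col B))"

definition hermitian :: "complex mat \<Rightarrow> bool"
  where "hermitian A \<longleftrightarrow> square_mat A \<and> mat_adjoint A = A"

(* (A *\<^sub>v v) \<bullet>c v is v^* A v; the order on complex is componentwise with equal imaginary
   parts, so 0 \<le> z says that z is real and nonnegative. *)
definition pos_semidef :: "complex mat \<Rightarrow> bool"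
  where "pos_semidef A \<longleftrightarrow> hermitian A \<and>
    (\<forall>v \<in> carrier_vec (dim_row A). 0 \<le> (A *\<^sub>v v) \<bullet>c v)"

definition pos_def :: "complex mat \<Rightarrow> bool"
  where "pos_def A \<longleftrightarrow> hermitian A \<and>
    (\<forall>v \<in> carrier_vec (dim_row A). v \<noteq> 0\<^sub>v (dim_row A) \<longrightarrow> 0 < (A *\<^sub>v v) \<bullet>c v)"

(* Meaningful for positive definite B only: existence and uniqueness hold there. *)
definition pd_sqrt :: "complex mat \<Rightarrow> complex mat"
  where "pd_sqrt B = (THE S. pos_def S \<and> S * S = B)"

definition inv_pd_sqrt :: "complex mat \<Rightarrow> complex mat"
  where "inv_pd_sqrt B = the (mat_inverse (pd_sqrt B))"

(* X^* M X = I_n, with X of the same size as M. *)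
definition unitary_wrt :: "complex mat \<Rightarrow> complex mat \<Rightarrow> bool"
  where "unitary_wrt M X \<longleftrightarrow> X \<in> carrier_mat (dim_row M) (dim_row M) \<and>
    mat_adjoint X * M * X = 1\<^sub>m (dim_row M)"

definition unitary :: "complex mat \<Rightarrow> bool"
  where "unitary Q \<longleftrightarrow> square_mat Q \<and> mat_adjoint Q * Q = 1\<^sub>m (dim_row Q)"

(* Q^* A = [R; 0] with Q unitary, R upper triangular (trapezoidal if not square), and k zero rows. *)
definition qr_factorization :: "complex mat \<Rightarrow> complex mat \<Rightarrow> complex mat \<Rightarrow> nat \<Rightarrow> bool"
  where "qr_factorization A Q R k \<longleftrightarrow>
    Q \<in> carrier_mat (dim_row A) (dim_row A) \<and> unitary Q \<and> upper_triangular R \<and>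
    mat_adjoint Q * A = R @\<^sub>r 0\<^sub>m k (dim_col A)"

abbreviation mat_rank :: "complex mat \<Rightarrow> nat"
  where "mat_rank A \<equiv> vec_space.rank (dim_row A) A"

abbreviation col_span :: "complex mat \<Rightarrow> complex vec set"
  where "col_span A \<equiv>
    LinearCombinations.module.span class_ring (module_vec TYPE(complex) (dim_row A)) (set (cols A))"

(* Matrix polynomials are represented by their evaluation maps. The spectrum is used for
   regular ones only. *)
definition regular :: "(complex \<Rightarrow> complex mat) \<Rightarrow> bool"
  where "regular R \<longleftrightarrow> (\<exists>z. det (R z) \<noteq> 0)"

definition spectrum_of :: "(complex \<Rightarrow> complex mat) \<Rightarrow> complex set"  (\<open>\<Lambda>\<close>)
  where "\<Lambda> R = {z. det (R z) = 0}"

definition geom_mult :: "(complex \<Rightarrow> complex mat) \<Rightarrow> complex \<Rightarrow> nat"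
  where "geom_mult R \<mu> = kernel_dim (R \<mu>)"

end

theory Submission
  imports Defs "Jordan_Normal_Form.Spectral_Radius"
begin

text \<open>If \<open>P(i\<omega>) v = 0\<close>, then \<open>0 = Im (v\<^sup>* P(i\<omega>) v) = \<omega> v\<^sup>* D v\<close>, so \<open>D v = 0\<close> as
  \<open>D \<ge> 0\<close>. Hence the kernel of \<open>P(i\<omega>)\<close> is that of \<open>N\<^sup>*\<close> for \<open>N = [P\<^sub>0(i\<omega>) D]\<close>, and its dimension is
  \<open>n - rank N\<close>. On the columns of \<open>X\<^sub>2\<close> the polynomial acts as \<open>P(\<lambda>) X\<^sub>2 = (\<lambda>\<^sup>2 + \<omega>\<^sup>2) M X\<^sub>2\<close>,
  so \<open>M\<close>-orthogonality of \<open>X\<^sub>1\<close> and \<open>X\<^sub>2\<close> gives the block structure. The block \<open>X\<^sub>1\<^sup>* P(\<lambda>) X\<^sub>1\<close> is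
  nonsingular at \<open>\<plusminus>i\<omega>\<close>, because the whole kernel has been moved into the range of \<open>X\<^sub>2\<close>.\<close>

section \<open>Adjoints and rank\<close>

text \<open>The square of \<open>i\<omega>\<close> is the real number -\<omega>^2, so
  \<open>P0 i\<omega>\<close> is Hermitian like \<open>D\<close>, and N^* v is
  \<open>P0 i\<omega>\<close> v stacked on D v. This is why the kernel of N^*, and not that of
  \<open>N\<close>, meets the kernel of \<open>P i\<omega>\<close>. The rank of \<open>N\<close> is
  defined by its columns, so the passage to N^* rests on the equality of the ranks of a matrix and
  its adjoint. The same two equations give K x = \<omega>^2 M x and D x = 0 on the kernel, which is
  the origin of the factor z^2 + \<omega>^2. The main obstacle is B^(-1/2). Since
  \<open>pd_sqrt\<close> is a definite description, nothing can be said about \<open>X1\<close> and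
  \<open>X2\<close> before existence and uniqueness of the positive definite root are proved. After
  that, two properties of T = B^(-1/2) carry the argument: T is invertible, and T^* B T is the
  identity. The points i\<omega> and -i\<omega> are handled together: \<open>P0\<close> depends on
  its argument through the square only, hence \<open>P\<close> has the same kernel at both.\<close>

lemma mat_adjoint_eq: "mat_adjoint A = map_mat cnj (transpose_mat A)"
  by (rule eq_matI) (auto simp: mat_adjoint_def mat_of_rows_def)

lemma mat_adjoint_carrier [simp]: "A \<in> carrier_mat n m \<Longrightarrow> mat_adjoint A \<in> carrier_mat m n" for A :: "complex mat"
  by (auto simp: mat_adjoint_eq)

lemma dim_mat_adjoint [simp]:
  "dim_row (mat_adjoint A) = dim_col A" "dim_col (mat_adjoint A) = dim_row A" for A :: "complex mat"
  by (auto simp: mat_adjoint_eq)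

lemma mat_adjoint_adjoint [simp]: "mat_adjoint (mat_adjoint A) = A" for A :: "complex mat"
  by (rule eq_matI) (auto simp: mat_adjoint_eq)

lemma mat_adjoint_zero [simp]: "mat_adjoint (0\<^sub>m n m :: complex mat) = 0\<^sub>m m n"
  by (rule eq_matI) (auto simp: mat_adjoint_eq)

lemma mat_adjoint_one [simp]: "mat_adjoint (1\<^sub>m n :: complex mat) = 1\<^sub>m n"
  by (rule eq_matI) (auto simp: mat_adjoint_eq)

lemma mat_adjoint_mult:
  fixes A B :: "complex mat"
  assumes "dim_col A = dim_row B"
  shows "mat_adjoint (A * B) = mat_adjoint B * mat_adjoint A"
  using assms
  by (intro eq_matI) (auto simp: mat_adjoint_eq scalar_prod_def mult.commute)

text \<open>Carrier premises contain sizes that a rewriting step would have to guess. Equations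
  between dimensions do not, so products can be regrouped by simplification.\<close>

lemma assoc_mult_mat_dim:
  fixes A B C :: "'a :: semiring_0 mat"
  assumes "dim_col A = dim_row B" "dim_col B = dim_row C"
  shows "A * B * C = A * (B * C)"
  using assms by (intro assoc_mult_mat) (auto intro: carrier_matI)

lemma assoc_mult_mat_vec_dim:
  fixes A B :: "'a :: semiring_0 mat"
  assumes "dim_col A = dim_row B" "dim_col B = dim_vec v"
  shows "(A * B) *\<^sub>v v = A *\<^sub>v (B *\<^sub>v v)"
  using assms by (intro assoc_mult_mat_vec) (auto intro: carrier_matI carrier_vecI)

lemma mat_adjoint_add:
  fixes A B :: "complex mat"
  assumes "A \<in> carrier_mat n m" "B \<in> carrier_mat n m"
  shows "mat_adjoint (A + B) = mat_adjoint A + mat_adjoint B"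
  using assms by (intro eq_matI) (auto simp: mat_adjoint_eq)

lemma mat_adjoint_smult: "mat_adjoint (c \<cdot>\<^sub>m A) = cnj c \<cdot>\<^sub>m mat_adjoint A"
  by (rule eq_matI) (auto simp: mat_adjoint_eq)

lemma cscalar_prod_adjoint:
  fixes A :: "complex mat"
  assumes A: "A \<in> carrier_mat n m" and v: "v \<in> carrier_vec m" and w: "w \<in> carrier_vec n"
  shows "(A *\<^sub>v v) \<bullet>c w = v \<bullet>c (mat_adjoint A *\<^sub>v w)"
proof -
  have "conjugate (mat_adjoint A *\<^sub>v w) = transpose_mat A *\<^sub>v conjugate w"
    using assms by (intro eq_vecI) (auto simp: mat_adjoint_eq scalar_prod_def)
  then show ?thesis
    using assms transpose_vec_mult_scalar[OF A v, of "conjugate w"]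
    by (metis carrier_vec_conjugate comm_scalar_prod mult_mat_vec_carrier transpose_carrier_mat)
qed

text \<open>Pairing A^* A v with v gives the squared norm of A v.\<close>

lemma mult_vec_zero_iff_adjoint:
  fixes A :: "complex mat"
  assumes "A \<in> carrier_mat n m" and "v \<in> carrier_vec m"
  shows "mat_adjoint A *\<^sub>v (A *\<^sub>v v) = 0\<^sub>v m \<longleftrightarrow> A *\<^sub>v v = 0\<^sub>v n"
proof
  assume "mat_adjoint A *\<^sub>v (A *\<^sub>v v) = 0\<^sub>v m"
  then have "(A *\<^sub>v v) \<bullet>c (A *\<^sub>v v) = 0"
    using assms by (subst cscalar_prod_adjoint[OF assms(1)]) auto
  then show "A *\<^sub>v v = 0\<^sub>v n" using assms by (metis conjugate_square_eq_0_vec mult_mat_vec_carrier)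
qed (use assms in auto)

section \<open>Rank and nullity of a matrix and of its adjoint\<close>

lemma rank_nullity:
  fixes A :: "'a :: field mat"
  assumes A: "A \<in> carrier_mat nr nc"
  shows "vec_space.rank nr A + kernel_dim A = nc"
proof -
  interpret V: vec_space "TYPE('a)" nc .
  interpret W: vec_space "TYPE('a)" nr .
  interpret L: linear_map class_ring "module_vec TYPE('a) nc" "module_vec TYPE('a) nr" "\<lambda>v. A *\<^sub>v v"
    apply unfold_locales
    using A apply (auto simp: LinearCombinations.module_hom_def mult_add_distrib_mat_vec[OF A] module_vec_simps)
    done
  \<comment> \<open>Identifying image and kernel of the linear map with column space and
    \<open>mat_kernel\<close> turns the abstract rank-nullity theorem into the one for
    matrices.\<close>
  have "L.imT = W.col_space A" 
    using A unfolding L.im_def W.col_space_eq[OF A] by (auto simp: module_vec_simps)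
  moreover have "L.kerT = mat_kernel A"
    using A unfolding L.ker_def mat_kernel[OF A] by (auto simp: module_vec_simps)
  ultimately show ?thesis
    using L.rank_nullity[OF V.fin_dim] A V.dim_is_n
    unfolding W.rank_def kernel_dim_def W.col_space_def by auto
qed

lemma rank_mono:
  fixes A B :: "'a :: field mat"
  assumes A: "A \<in> carrier_mat n k" and B: "B \<in> carrier_mat n m"
    and "vec_space.col_space n A \<subseteq> vec_space.col_space n B"
  shows "vec_space.rank n A \<le> vec_space.rank n B"
proof -
  interpret W: vec_space "TYPE('a)" n .
  have *: "set (cols A) \<subseteq> carrier_vec n" "set (cols B) \<subseteq> carrier_vec n"
    using A B cols_dim by blast+
  have vs: "vectorspace class_ring (W.vs (W.span (set (cols B))))"
    using * by (intro W.subspace_is_vs W.span_is_subspace) auto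
  have sub: "VectorSpace.subspace class_ring (W.span (set (cols A))) (W.vs (W.span (set (cols B))))"
    using assms * unfolding W.col_space_def by (intro W.nested_subspaces W.span_is_subspace) auto
  show ?thesis
    using vectorspace.subspace_dim[OF vs sub] W.fin_dim_span[of "set (cols A)"] W.fin_dim_span[of "set (cols B)"] *
    unfolding W.rank_def by auto
qed

text \<open>A A^* and A^* have the same kernel and both have n columns, so their ranks agree. The
  column space of A A^* lies in that of A. Applying the inequality to A^* as well gives
  equality.\<close>

lemma rank_mat_adjoint_le:
  fixes A :: "complex mat"
  assumes A: "A \<in> carrier_mat n m"
  shows "vec_space.rank m (mat_adjoint A) \<le> vec_space.rank n A"
proof -
  define B where "B = A * mat_adjoint A"
  have A': "mat_adjoint A \<in> carrier_mat m n" and B: "B \<in> carrier_mat n n"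
    using A by (auto simp: B_def)
  have "mat_kernel B = mat_kernel (mat_adjoint A)"
    using mult_vec_zero_iff_adjoint[OF A'] A A'
    by (auto simp: mat_kernel[OF B] mat_kernel[OF A'] assoc_mult_mat_vec[OF A A'] B_def[THEN arg_cong, of "\<lambda>X. X *\<^sub>v _"])
  then have "kernel_dim B = kernel_dim (mat_adjoint A)"
    using A A' B by (simp add: kernel_dim_def)
  then have "vec_space.rank m (mat_adjoint A) = vec_space.rank n B"
    using rank_nullity[OF A'] rank_nullity[OF B] by simp
  also have "\<dots> \<le> vec_space.rank n A"
  proof (rule rank_mono[OF B A])
    interpret W: vec_space "TYPE(complex)" n .
    show "W.col_space B \<subseteq> W.col_space A"
    proof
      fix y assume "y \<in> W.col_space B"
      then obtain x where x: "x \<in> carrier_vec n" "y = B *\<^sub>v x"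
        using W.col_space_eq[OF B] B by auto
      then have "y = A *\<^sub>v (mat_adjoint A *\<^sub>v x)"
        using assoc_mult_mat_vec[OF A A'] by (simp add: B_def)
      moreover have "mat_adjoint A *\<^sub>v x \<in> carrier_vec m"
        using A' x by simp
      ultimately show "y \<in> W.col_space A"
        using W.col_space_eq[OF A] A by auto
    qed
  qed
  finally show ?thesis .
qed

lemma rank_mat_adjoint:
  fixes A :: "complex mat"
  assumes A: "A \<in> carrier_mat n m"
  shows "vec_space.rank m (mat_adjoint A) = vec_space.rank n A"
  using rank_mat_adjoint_le[OF A] rank_mat_adjoint_le[OF mat_adjoint_carrier[OF A]] by simp

lemma rank_plus_adjoint_kernel_dim:
  fixes A :: "complex mat"
  assumes A: "A \<in> carrier_mat n m"
  shows "vec_space.rank n A + kernel_dim (mat_adjoint A) = n"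
  using rank_nullity[OF mat_adjoint_carrier[OF A]] rank_mat_adjoint[OF A] by simp

lemma kernel_dim_zero_imp_trivial:
  fixes A :: "'a :: field mat"
  assumes A: "A \<in> carrier_mat n m" and "kernel_dim A = 0" and v: "v \<in> carrier_vec m" "A *\<^sub>v v = 0\<^sub>v n"
  shows "v = 0\<^sub>v m"
proof -
  interpret kernel n m A by unfold_locales (rule A)
  obtain S where S: "finite S" "basis S" using kernel_basis_exists[OF A] by auto
  then have "S = {}" using Ker.dim_basis[OF S] assms(2) by simp
  then have "mat_kernel A = {0\<^sub>v m}" using S Ker.span_empty unfolding Ker.basis_def by auto
  then show ?thesis using v mat_kernel[OF A] by auto
qed

section \<open>Positive definite matrices and their square roots\<close>

text \<open>Reads entries of a congruence as values of a sesquilinear form on columns. With A the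
  identity it expresses orthonormality, with X = Y it puts form values on the diagonal.\<close>

lemma index_adjoint_mult_mult:
  fixes A X Y :: "complex mat"
  assumes "A \<in> carrier_mat n n" "X \<in> carrier_mat n k" "Y \<in> carrier_mat n m" "i < k" "j < m"
  shows "(mat_adjoint X * A * Y) $$ (i, j) = (A *\<^sub>v col Y j) \<bullet>c col X i"
proof -
  have "mat_adjoint X * A * Y = mat_adjoint X * (A * Y)"
    using assms by (intro assoc_mult_mat) auto
  moreover have "row (mat_adjoint X) i = conjugate (col X i)"
    using assms by (intro eq_vecI) (auto simp: mat_adjoint_eq)
  moreover have "col (A * Y) j = A *\<^sub>v col Y j"
    using assms by auto
  ultimately show ?thesis
    using assms by (auto intro!: comm_scalar_prod[of _ n])
qed

lemma hermitian_carrier_iff: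
  "A \<in> carrier_mat n n \<Longrightarrow> hermitian A \<longleftrightarrow> mat_adjoint A = A"
  by (auto simp: hermitian_def)

lemma hermitian_congruence:
  assumes "A \<in> carrier_mat n n" "hermitian A" "X \<in> carrier_mat n m"
  shows "hermitian (mat_adjoint X * A * X)"
proof -
  have "mat_adjoint (mat_adjoint X * A * X) = mat_adjoint X * (A * X)"
    using assms by (auto simp: mat_adjoint_mult hermitian_carrier_iff)
  also have "\<dots> = mat_adjoint X * A * X"
    using assms by (intro assoc_mult_mat[symmetric]) auto
  finally show ?thesis using assms by (simp add: hermitian_def)
qed

lemma congruence_form:
  fixes A X :: "complex mat"
  assumes "A \<in> carrier_mat n n" "X \<in> carrier_mat n m" "v \<in> carrier_vec m"
  shows "((mat_adjoint X * A * X) *\<^sub>v v) \<bullet>c v = (A *\<^sub>v (X *\<^sub>v v)) \<bullet>c (X *\<^sub>v v)"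
proof -
  have "(mat_adjoint X * A * X) *\<^sub>v v = mat_adjoint X *\<^sub>v (A *\<^sub>v (X *\<^sub>v v))"
    using assms by (auto simp: assoc_mult_mat_vec_dim)
  then show ?thesis
    using assms cscalar_prod_adjoint[of "mat_adjoint X" m n "A *\<^sub>v (X *\<^sub>v v)" v] by auto
qed

lemma pos_def_carrier_iff:
  "A \<in> carrier_mat n n \<Longrightarrow> pos_def A \<longleftrightarrow> mat_adjoint A = A \<and>
    (\<forall>v \<in> carrier_vec n. v \<noteq> 0\<^sub>v n \<longrightarrow> 0 < (A *\<^sub>v v) \<bullet>c v)"
  by (auto simp: pos_def_def hermitian_def)

lemma pos_semidef_carrier_iff:
  "A \<in> carrier_mat n n \<Longrightarrow> pos_semidef A \<longleftrightarrow> mat_adjoint A = A \<and>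
    (\<forall>v \<in> carrier_vec n. 0 \<le> (A *\<^sub>v v) \<bullet>c v)"
  by (auto simp: pos_semidef_def hermitian_def)

lemma pos_def_imp_pos_semidef:
  assumes "pos_def A"
  shows "pos_semidef A"
proof -
  have "0 \<le> (A *\<^sub>v v) \<bullet>c v" if "v \<in> carrier_vec (dim_row A)" for v
    using assms that by (cases "v = 0\<^sub>v (dim_row A)") (auto simp: pos_def_def hermitian_def less_le scalar_prod_def)
  then show ?thesis using assms by (simp add: pos_def_def pos_semidef_def)
qed

text \<open>An injective \<open>X\<close> maps nonzero vectors to nonzero vectors. It may be tall,
  so this covers unitary changes of basis, compressions to coordinates and matrices with orthonormal
  columns.\<close>

lemma pos_def_congruence:
  assumes "A \<in> carrier_mat n n" "pos_def A" "X \<in> carrier_mat n m"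
    and "\<And>v. v \<in> carrier_vec m \<Longrightarrow> X *\<^sub>v v = 0\<^sub>v n \<Longrightarrow> v = 0\<^sub>v m"
  shows "pos_def (mat_adjoint X * A * X)"
proof -
  have "mat_adjoint (mat_adjoint X * A * X) = mat_adjoint X * A * X"
    using hermitian_congruence[of A n X m] assms by (auto simp: pos_def_def hermitian_def)
  moreover have "0 < ((mat_adjoint X * A * X) *\<^sub>v v) \<bullet>c v" if "v \<in> carrier_vec m" "v \<noteq> 0\<^sub>v m" for v
    using assms(2,4) that mult_mat_vec_carrier[OF assms(3) that(1)]
    unfolding congruence_form[OF assms(1,3) that(1)] pos_def_carrier_iff[OF assms(1)] by blast
  ultimately show ?thesis
    using assms by (subst pos_def_carrier_iff[of _ m]) (auto intro!: mult_carrier_mat)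
qed

lemma pos_def_det_nonzero:
  assumes "A \<in> carrier_mat n n" "pos_def A"
  shows "det A \<noteq> 0"
proof
  assume "det A = 0"
  then obtain v where v: "v \<in> carrier_vec n" "v \<noteq> 0\<^sub>v n" "A *\<^sub>v v = 0\<^sub>v n"
    using det_0_iff_vec_prod_zero_field[OF assms(1)] by auto
  then show False using assms by (auto simp: pos_def_carrier_iff)
qed

section \<open>Zeros of a semidefinite form, and uniqueness of the square root\<close>

lemma mult_mat_vec_lincomb:
  fixes A :: "complex mat"
  assumes "A \<in> carrier_mat n n" "v \<in> carrier_vec n" "w \<in> carrier_vec n"
  shows "A *\<^sub>v (v + c \<cdot>\<^sub>v w) = A *\<^sub>v v + c \<cdot>\<^sub>v (A *\<^sub>v w)"
  using assms by (simp add: mult_add_distrib_mat_vec[of _ n n] mult_mat_vec[of _ n n])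

text \<open>If the form vanishes at \<open>v\<close>, then along \<open>v - t Av\<close> it equals
  \<open>- 2 t |Av|\<^sup>2 + O(t\<^sup>2)\<close>, which is negative for small \<open>t > 0\<close> unless \<open>Av = 0\<close>.\<close>
lemma pos_semidef_form_eq_0:
  assumes A: "A \<in> carrier_mat n n" and psd: "pos_semidef A"
    and v: "v \<in> carrier_vec n" and form: "(A *\<^sub>v v) \<bullet>c v = 0"
  shows "A *\<^sub>v v = 0\<^sub>v n"
proof (rule ccontr)
  assume "A *\<^sub>v v \<noteq> 0\<^sub>v n"
  define w where "w = A *\<^sub>v v"
  have w: "w \<in> carrier_vec n" using A v by (simp add: w_def)
  have "0 < w \<bullet>c w" using \<open>A *\<^sub>v v \<noteq> 0\<^sub>v n\<close> w conjugate_square_greater_0_vec[OF w] by (simp add: w_def)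
  then obtain s :: real where s: "w \<bullet>c w = of_real s" "s > 0"
    by (intro that[of "Re (w \<bullet>c w)"]) (auto simp: less_complex_def complex_eq_iff)
  have "0 \<le> (A *\<^sub>v w) \<bullet>c w" using psd A w by (auto simp: pos_semidef_carrier_iff)
  then obtain c :: real where c: "(A *\<^sub>v w) \<bullet>c w = of_real c" "c \<ge> 0"
    by (intro that[of "Re ((A *\<^sub>v w) \<bullet>c w)"]) (auto simp: less_eq_complex_def complex_eq_iff)
  have Awv: "(A *\<^sub>v w) \<bullet>c v = w \<bullet>c w"
    using cscalar_prod_adjoint[OF A w v] psd A by (simp add: pos_semidef_carrier_iff w_def)
  have "0 \<le> - 2 * t * s + t^2 * c" for t :: real
  proof -
    have "0 \<le> (A *\<^sub>v (v + (- of_real t) \<cdot>\<^sub>v w)) \<bullet>c (v + (- of_real t) \<cdot>\<^sub>v w)"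
      using psd A v w by (auto simp: pos_semidef_carrier_iff)
    also have "A *\<^sub>v (v + (- of_real t) \<cdot>\<^sub>v w) = w + (- of_real t) \<cdot>\<^sub>v (A *\<^sub>v w)"
      using mult_mat_vec_lincomb[OF A v w] by (simp add: w_def)
    also have "(w + (- of_real t) \<cdot>\<^sub>v (A *\<^sub>v w)) \<bullet>c (v + (- of_real t) \<cdot>\<^sub>v w)
        = w \<bullet>c v - t * (w \<bullet>c w) - t * ((A *\<^sub>v w) \<bullet>c v) + t^2 * ((A *\<^sub>v w) \<bullet>c w)"
      using A v w
      by (simp add: conjugate_add_vec[of _ n] conjugate_smult_vec add_scalar_prod_distrib[of _ n]
          scalar_prod_add_distrib[of _ n] power2_eq_square algebra_simps)
    also have "\<dots> = of_real (- 2 * t * s + t^2 * c)"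
      using form by (simp add: Awv s c w_def[symmetric])
    finally show ?thesis by (simp add: less_eq_complex_def)
  qed
  \<comment> \<open>For t = s / (c + 1) one has t > 0 and t c < s, also if c = 0, so -2 s + t c is
    negative.\<close>
  from this[of "s / (c + 1)"] have "0 \<le> (s / (c + 1)) * (- 2 * s + (s / (c + 1)) * c)"
    unfolding power2_eq_square distrib_left by (simp only: mult.assoc mult.left_commute mult.commute)
  moreover have "s / (c + 1) > 0" using s c by simp
  moreover have "(s / (c + 1)) * c < s" using s c by (simp add: field_simps)
  ultimately show False using s by (smt (verit) mult_pos_neg)
qed

lemma mat_adjoint_minus:
  fixes A B :: "complex mat"
  assumes "A \<in> carrier_mat n m" "B \<in> carrier_mat n m"
  shows "mat_adjoint (A - B) = mat_adjoint A - mat_adjoint B"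
  using assms by (intro eq_matI) (auto simp: mat_adjoint_eq)

text \<open>Cyclicity of the trace, for rectangular factors: both sides are the same double sum in
  two orders.\<close>

lemma sum_diag_mult_comm:
  fixes A B :: "'a :: comm_semiring_0 mat"
  assumes "A \<in> carrier_mat n m" "B \<in> carrier_mat m n"
  shows "(\<Sum>i<n. (A * B) $$ (i, i)) = (\<Sum>i<m. (B * A) $$ (i, i))"
proof -
  have "(\<Sum>i<n. (A * B) $$ (i, i)) = (\<Sum>i<n. \<Sum>j<m. A $$ (i, j) * B $$ (j, i))"
    using assms by (intro sum.cong) (auto simp: scalar_prod_def lessThan_atLeast0)
  also have "\<dots> = (\<Sum>j<m. \<Sum>i<n. B $$ (j, i) * A $$ (i, j))"
    by (subst sum.swap) (simp add: mult.commute)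
  also have "\<dots> = (\<Sum>i<m. (B * A) $$ (i, i))"
    using assms by (intro sum.cong) (auto simp: scalar_prod_def lessThan_atLeast0)
  finally show ?thesis .
qed

text \<open>For \<open>d = S - T\<close> we have \<open>S d + d T = 0\<close>. Multiplying by \<open>d\<close> and taking traces,
  \<open>tr (d S d) + tr (d T d) = 0\<close>, a sum of nonnegative terms.\<close>
lemma pos_def_square_inj:
  assumes S: "S \<in> carrier_mat n n" "pos_def S" and T: "T \<in> carrier_mat n n" "pos_def T"
    and eq: "S * S = T * T"
  shows "S = T"
proof -
  define d where "d = S - T"
  have d: "d \<in> carrier_mat n n" using S T by (simp add: d_def minus_carrier_mat)
  have adj: "mat_adjoint d = d"
    using S T by (simp add: d_def mat_adjoint_minus[of S n n T] pos_def_carrier_iff[of _ n])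
  have "S * d + d * T = 0\<^sub>m n n"
  proof -
    have "S * d = S * S - S * T" "d * T = S * T - T * T"
      using S T by (auto simp: d_def mult_minus_distrib_mat[of _ n n] minus_mult_distrib_mat[of _ n n])
    then show ?thesis using S T by (intro eq_matI) (auto simp: eq)
  qed
  then have "d * (S * d) + d * (d * T) = 0\<^sub>m n n"
    using d S T mult_add_distrib_mat[of d n n "S * d" n "d * T"] by (auto simp: mult_carrier_mat)
  moreover have "(d * (S * d)) $$ (i, i) + (d * (d * T)) $$ (i, i) = (d * (S * d) + d * (d * T)) $$ (i, i)"
    if "i < n" for i
    using d S T that by (intro index_add_mat(1)[symmetric]) auto
  ultimately have "(\<Sum>i<n. (d * (S * d)) $$ (i, i) + (d * (d * T)) $$ (i, i)) = 0"
    by simp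
  \<comment> \<open>Cyclicity of the trace moves the outer \<open>d\<close> of the second summand to
    the right, so that both sums have the shape d A d.\<close>
  then have "(\<Sum>i<n. (d * (S * d)) $$ (i, i)) + (\<Sum>i<n. (d * T * d) $$ (i, i)) = 0"
    using sum_diag_mult_comm[of d n n "d * T"] d T by (simp add: sum.distrib mult_carrier_mat)
  \<comment> \<open>Since \<open>d\<close> is self-adjoint, the entry (i, i) of d A d is the form of
    A at column i of \<open>d\<close>. Strict positivity makes the column vanish with it.\<close>
  moreover have nonneg: "0 \<le> (d * A * d) $$ (i, i)" and zero: "(d * A * d) $$ (i, i) = 0 \<Longrightarrow> col d i = 0\<^sub>v n"
    if "A \<in> carrier_mat n n" "pos_def A" "i < n" for A i
  proof -
    have "(d * A * d) $$ (i, i) = (A *\<^sub>v col d i) \<bullet>c col d i"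
      using index_adjoint_mult_mult[of A n d n d n i i] that d adj by simp
    moreover have "col d i \<in> carrier_vec n" using d that by auto
    ultimately show "0 \<le> (d * A * d) $$ (i, i)" "(d * A * d) $$ (i, i) = 0 \<Longrightarrow> col d i = 0\<^sub>v n"
      using that pos_def_imp_pos_semidef[of A] pos_semidef_carrier_iff[of A n] pos_def_carrier_iff[of A n]
      by (auto simp: less_le)
  qed
  moreover have "d * (S * d) = d * S * d"
    using d S by (auto simp: assoc_mult_mat_dim)
  ultimately have "(\<Sum>i<n. (d * S * d) $$ (i, i)) = 0"
    using sum_nonneg[of "{..<n}" "\<lambda>i. (d * S * d) $$ (i, i)"] sum_nonneg[of "{..<n}" "\<lambda>i. (d * T * d) $$ (i, i)"]
      S T by (simp add: add_nonneg_eq_0_iff)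
  then have "(d * S * d) $$ (i, i) = 0" if "i < n" for i
    using sum_nonneg_eq_0_iff[of "{..<n}" "\<lambda>i. (d * S * d) $$ (i, i)"] nonneg S that by auto
  then have "col d i = 0\<^sub>v n" if "i < n" for i using zero S that by auto
  then have "d $$ (j, i) = 0" if "i < n" "j < n" for i j
    using d that by (metis carrier_matD index_col index_zero_vec(1))
  then have "S $$ (j, i) = T $$ (j, i)" if "i < n" "j < n" for i j
    using S T that by (auto simp: d_def)
  then show ?thesis using S T by (intro eq_matI) auto
qed

section \<open>Existence of the positive definite square root\<close>

lemma conjugate_append_vec: "conjugate (a @\<^sub>v b) = conjugate a @\<^sub>v conjugate b"
  by (rule eq_vecI) auto

lemma mat_adjoint_four_block:
  fixes A B C D :: "complex mat"
  assumes "A \<in> carrier_mat n1 m1" "B \<in> carrier_mat n1 m2" "C \<in> carrier_mat n2 m1" "D \<in> carrier_mat n2 m2"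
  shows "mat_adjoint (four_block_mat A B C D) =
    four_block_mat (mat_adjoint A) (mat_adjoint C) (mat_adjoint B) (mat_adjoint D)"
  using assms by (intro eq_matI) (auto simp: mat_adjoint_eq)

lemma pos_def_four_block_diag:
  assumes A: "A \<in> carrier_mat n n" "pos_def A" and D: "D \<in> carrier_mat m m" "pos_def D"
  shows "pos_def (four_block_mat A (0\<^sub>m n m) (0\<^sub>m m n) D)" (is "pos_def ?F")
proof -
  have F: "?F \<in> carrier_mat (n + m) (n + m)" using A D by simp
  have "mat_adjoint ?F = ?F"
    using A D by (subst mat_adjoint_four_block[of _ n n _ m _ m]) (auto simp: pos_def_carrier_iff)
  moreover have "0 < (?F *\<^sub>v v) \<bullet>c v" if v: "v \<in> carrier_vec (n + m)" "v \<noteq> 0\<^sub>v (n + m)" for v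
  proof -
    define a b where "a = vec_first v n" and "b = vec_last v m"
    have a: "a \<in> carrier_vec n" and b: "b \<in> carrier_vec m" and ab: "v = a @\<^sub>v b"
      using v by (auto simp: a_def b_def)
    have "?F *\<^sub>v v = (A *\<^sub>v a) @\<^sub>v (D *\<^sub>v b)"
      using four_block_mat_mult_vec[OF A(1) _ _ D(1) a b, of "0\<^sub>m n m" "0\<^sub>m m n"] A D a b ab by auto
    then have "(?F *\<^sub>v v) \<bullet>c v = (A *\<^sub>v a) \<bullet>c a + (D *\<^sub>v b) \<bullet>c b"
      using scalar_prod_append[of "A *\<^sub>v a" n "D *\<^sub>v b" m "conjugate a" "conjugate b"] A D a b
      by (simp add: ab conjugate_append_vec)
    moreover have "0 \<le> (A *\<^sub>v a) \<bullet>c a" "0 \<le> (D *\<^sub>v b) \<bullet>c b"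
      using pos_def_imp_pos_semidef[OF A(2)] pos_def_imp_pos_semidef[OF D(2)] A D a b
      by (auto simp: pos_semidef_carrier_iff)
    moreover have "a \<noteq> 0\<^sub>v n \<or> b \<noteq> 0\<^sub>v m" using v ab by auto
    then have "0 < (A *\<^sub>v a) \<bullet>c a \<or> 0 < (D *\<^sub>v b) \<bullet>c b"
      using A D a b by (auto simp: pos_def_carrier_iff)
    ultimately show ?thesis by (auto intro: add_pos_nonneg add_nonneg_pos)
  qed
  ultimately show ?thesis using pos_def_carrier_iff[OF F] by auto
qed

lemma pos_def_single:
  assumes "0 < (s :: complex)"
  shows "pos_def (mat 1 1 (\<lambda>_. s))"
proof -
  have s: "0 < Re s" "Im s = 0" using assms by (auto simp: less_complex_def)
  have "0 < (mat 1 1 (\<lambda>_. s) *\<^sub>v v) \<bullet>c v" if "v \<in> carrier_vec 1" "v \<noteq> 0\<^sub>v 1" for v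
  proof -
    have "v $ 0 \<noteq> 0" using that by (auto simp: vec_eq_iff)
    moreover have "(mat 1 1 (\<lambda>_. s) *\<^sub>v v) \<bullet>c v = s * (v $ 0 * cnj (v $ 0))"
      using that by (auto simp: scalar_prod_def)
    ultimately show ?thesis
      using s by (simp add: less_complex_def complex_mult_cnj sum_power2_gt_zero_iff complex_eq_iff)
  qed
  moreover have "mat_adjoint (mat 1 1 (\<lambda>_. s)) = mat 1 1 (\<lambda>_. s)"
    using s by (intro eq_matI) (auto simp: mat_adjoint_eq complex_eq_iff)
  ultimately show ?thesis using pos_def_carrier_iff[of "mat 1 1 (\<lambda>_. s)" 1] by auto
qed

text \<open>Complete v to a basis, orthogonalize and divide by the norms. Gram-Schmidt keeps its
  first vector, so column 0 stays a multiple of v and hence an eigenvector whenever v is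
  one.\<close>

lemma unitary_completion:
  fixes v :: "complex vec"
  assumes v: "v \<in> carrier_vec n" "v \<noteq> 0\<^sub>v n"
  shows "\<exists>U c. U \<in> carrier_mat n n \<and> mat_adjoint U * U = 1\<^sub>m n \<and> col U 0 = c \<cdot>\<^sub>v v"
proof -
  interpret cof_vec_space n "TYPE(complex)" .
  define b where "b = basis_completion v"
  define ws where "ws = gram_schmidt n b"
  note bc = basis_completion[OF v, folded b_def]
  note gs = gram_schmidt_result[OF bc(2,4,5) ws_def]
  have n: "n > 0" using v by (cases n) auto
  have len: "length ws = n" using gs(4) bc(6) by simp
  have w: "ws ! i \<in> carrier_vec n" if "i < n" for i using gs(3) len that by auto
  have "b \<noteq> []" using bc(6) n by auto
  then have "hd ws = v" 
    using gram_schmidt_hd[OF v(1)] bc(7) unfolding ws_def by (cases b) auto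
  then have ws0: "ws ! 0 = v" using len n by (cases ws) auto
  define c where "c i = complex_of_real (1 / sqrt (Re (ws ! i \<bullet>c ws ! i)))" for i
  have pos: "0 < ws ! i \<bullet>c ws ! i" if "i < n" for i
    using corthogonalD[OF gs(2), of i i] len that conjugate_square_ge_0_vec[of "ws ! i"] by (auto simp: less_le)
  define U where "U = mat n n (\<lambda>(i, j). c j * (ws ! j) $ i)"
  have U: "U \<in> carrier_mat n n" by (simp add: U_def)
  have col: "col U j = c j \<cdot>\<^sub>v ws ! j" if "j < n" for j
    using that w[OF that] by (intro eq_vecI) (auto simp: U_def)
  have "mat_adjoint U * U = 1\<^sub>m n"
  proof (rule eq_matI)
    fix i j assume "i < dim_row (1\<^sub>m n :: complex mat)" "j < dim_col (1\<^sub>m n :: complex mat)"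
    then have ij: "i < n" "j < n" by auto
    have "(mat_adjoint U * U) $$ (i, j) = col U j \<bullet>c col U i"
      using index_adjoint_mult_mult[of "1\<^sub>m n" n U n U n i j] U ij by auto
    also have "\<dots> = c j * c i * (ws ! j \<bullet>c ws ! i)"
      using ij w[OF ij(1)] w[OF ij(2)] by (simp add: col conjugate_smult_vec c_def)
    also have "\<dots> = (if i = j then 1 else 0)"
    proof (cases "i = j")
      case True
      obtain r where r: "ws ! i \<bullet>c ws ! i = complex_of_real r" "r > 0"
        using pos[OF ij(1)] by (intro that[of "Re (ws ! i \<bullet>c ws ! i)"]) (auto simp: less_complex_def complex_eq_iff)
      have "c i * c i * complex_of_real r = complex_of_real (1 / sqrt r * (1 / sqrt r) * r)"
        by (simp only: c_def r of_real_mult Re_complex_of_real)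
      also have "1 / sqrt r * (1 / sqrt r) * r = 1"
        using r(2) by (simp add: field_simps)
      finally show ?thesis using True r by simp
    next
      case False
      then have "ws ! j \<bullet>c ws ! i = 0" using corthogonalD[OF gs(2), of j i] ij len by auto
      then show ?thesis using False by simp
    qed
    finally show "(mat_adjoint U * U) $$ (i, j) = 1\<^sub>m n $$ (i, j)" using ij by simp
  qed (use U in auto)
  then show ?thesis using U col[OF n] ws0 by auto
qed

lemma left_inverse_imp_inj:
  fixes X L :: "'a :: comm_ring_1 mat"
  assumes "X \<in> carrier_mat n m" "L \<in> carrier_mat m n" "L * X = 1\<^sub>m m"
    and "v \<in> carrier_vec m" "X *\<^sub>v v = 0\<^sub>v n"
  shows "v = 0\<^sub>v m"
proof -
  have "v = L *\<^sub>v (X *\<^sub>v v)"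
    using assoc_mult_mat_vec[of L m n X m v] assms by simp
  also have "\<dots> = 0\<^sub>v m" using assms by (auto simp: scalar_prod_def)
  finally show ?thesis .
qed

lemma conjugate_unit_vec [simp]: "conjugate (unit_vec n i :: complex vec) = unit_vec n i"
  by (rule eq_vecI) (auto simp: unit_vec_def)

text \<open>Induction on the size. A unitary change of basis puts an eigenvector into the first
  coordinate. The first column is then zero below the diagonal, and by Hermitian symmetry so is the
  first row beyond it. A scalar and a smaller positive definite block remain; their roots are
  assembled and rotated back.\<close>

lemma pos_def_sqrt_exists:
  "B \<in> carrier_mat n n \<Longrightarrow> pos_def B \<Longrightarrow> \<exists>S \<in> carrier_mat n n. pos_def S \<and> S * S = B"
proof (induction n arbitrary: B)
  case 0
  then have "B * B = B" by (intro eq_matI) auto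
  then show ?case using 0 by blast
next
  case (Suc n)
  note B = Suc.prems
  obtain e where "eigenvalue B e" using spectrum_non_empty[OF B(1)] by (auto simp: spectrum_def)
  then obtain v where v: "v \<in> carrier_vec (Suc n)" "v \<noteq> 0\<^sub>v (Suc n)" "B *\<^sub>v v = e \<cdot>\<^sub>v v"
    using B by (auto simp: eigenvalue_def eigenvector_def)
  obtain U c where U: "U \<in> carrier_mat (Suc n) (Suc n)" "mat_adjoint U * U = 1\<^sub>m (Suc n)" "col U 0 = c \<cdot>\<^sub>v v"
    using unitary_completion[OF v(1,2)] by auto
  have U': "U * mat_adjoint U = 1\<^sub>m (Suc n)"
    using mat_mult_left_right_inverse[OF _ U(1,2)] U(1) by simp
  have inj: "w = 0\<^sub>v (Suc n)" if "w \<in> carrier_vec (Suc n)" "U *\<^sub>v w = 0\<^sub>v (Suc n)" for w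
    using left_inverse_imp_inj[OF U(1) mat_adjoint_carrier[OF U(1)] U(2) that] .
  define C where "C = mat_adjoint U * B * U"
  have C: "C \<in> carrier_mat (Suc n) (Suc n)" using U B by (auto simp: C_def intro!: mult_carrier_mat)
  have pdC: "pos_def C" unfolding C_def using pos_def_congruence[OF B U(1) inj] by simp
  have adjC: "mat_adjoint C = C" using pdC pos_def_carrier_iff[OF C] by simp
  have U0: "col U 0 \<in> carrier_vec (Suc n)" using U(3) v(1) by simp
  have "col C 0 = mat_adjoint U *\<^sub>v (B *\<^sub>v col U 0)"
    using col_mult2[OF mult_carrier_mat[OF mat_adjoint_carrier[OF U(1)] B(1)] U(1), of 0]
      assoc_mult_mat_vec[OF mat_adjoint_carrier[OF U(1)] B(1) U0]
    by (simp add: C_def)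
  also have "\<dots> = e \<cdot>\<^sub>v (mat_adjoint U *\<^sub>v col U 0)"
  proof -
    have "B *\<^sub>v col U 0 = e \<cdot>\<^sub>v col U 0"
      using mult_mat_vec[OF B(1) v(1)] by (simp add: U(3) v(3) smult_smult_assoc mult.commute)
    then show ?thesis
      using mult_mat_vec[OF mat_adjoint_carrier[OF U(1)] U0] by simp
  qed
  also have "mat_adjoint U *\<^sub>v col U 0 = unit_vec (Suc n) 0"
    using U(1,2) by (subst col_mult2[symmetric, of _ "Suc n" "Suc n"]) auto
  finally have col0: "C $$ (Suc i, 0) = 0" if "i < n" for i
    using C that by (metis carrier_matD(1) carrier_matD(2) index_col Suc_less_eq index_smult_vec(1) index_unit_vec(1) mult_zero_right nat.distinct(1) zero_less_Suc index_unit_vec(3))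
  have row0: "C $$ (0, Suc i) = 0" if "i < n" for i
  proof -
    have "C $$ (0, Suc i) = mat_adjoint C $$ (0, Suc i)" using adjC by simp
    also have "\<dots> = 0" using C that col0 by (auto simp: mat_adjoint_eq simp del: adjC)
    finally show ?thesis .
  qed
  define l where "l = C $$ (0, 0)"
  define E where "E = mat n n (\<lambda>(i, j). C $$ (Suc i, Suc j))"
  have E: "E \<in> carrier_mat n n" by (simp add: E_def)
  have Cblock: "C = four_block_mat (mat 1 1 (\<lambda>_. l)) (0\<^sub>m 1 n) (0\<^sub>m n 1) E"
    using C col0 row0 by (intro eq_matI) (auto simp: l_def E_def less_Suc_eq_0_disj)
  \<comment> \<open>The eigenvalue was obtained as a complex number. Its positivity comes from
    reading \<open>l\<close> as the form of \<open>C\<close> at the first unit vector.\<close>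
  have "0 < l"
  proof -
    have "C *\<^sub>v unit_vec (Suc n) 0 = col C 0" using C by (intro eq_vecI) auto
    then have "(C *\<^sub>v unit_vec (Suc n) 0) \<bullet>c unit_vec (Suc n) 0 = l"
      using C by (auto simp: l_def conjugate_unit_vec)
    then show ?thesis using pdC pos_def_carrier_iff[OF C] unit_vec_nonzero[of 0 "Suc n"] by (metis unit_vec_carrier zero_less_Suc)
  qed
  \<comment> \<open>\<open>J\<close> embeds the last n coordinates, so \<open>E\<close> is the
    compression J^* C J and inherits positive definiteness from \<open>C\<close>.\<close>
  define J :: "complex mat" where "J = mat (Suc n) n (\<lambda>(i, j). if i = Suc j then 1 else 0)"
  have J: "J \<in> carrier_mat (Suc n) n" by (simp add: J_def)
  have colJ: "col J j = unit_vec (Suc n) (Suc j)" if "j < n" for j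
    using that by (intro eq_vecI) (auto simp: J_def)
  have "mat_adjoint J * C * J = E"
  proof (rule eq_matI)
    fix i j assume "i < dim_row E" "j < dim_col E"
    then have ij: "i < n" "j < n" using E by auto
    have "C *\<^sub>v unit_vec (Suc n) (Suc j) = col C (Suc j)"
      using C ij by (intro eq_vecI) auto
    then show "(mat_adjoint J * C * J) $$ (i, j) = E $$ (i, j)"
      using index_adjoint_mult_mult[OF C J J ij] C ij by (simp add: colJ conjugate_unit_vec E_def)
  qed (use C J E in auto)
  moreover have "w = 0\<^sub>v n" if "w \<in> carrier_vec n" "J *\<^sub>v w = 0\<^sub>v (Suc n)" for w
  proof (rule eq_vecI)
    fix i assume "i < dim_vec (0\<^sub>v n :: complex vec)"
    then have i: "i < n" by simp
    have "(J *\<^sub>v w) $ Suc i = w $ i"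
      using i that(1) by (simp add: J_def scalar_prod_def if_distrib[of "\<lambda>x. x * _"] cong: if_cong)
    then show "w $ i = 0\<^sub>v n $ i" using i that(2) by simp
  qed (use that in simp)
  ultimately have "pos_def E" using pos_def_congruence[OF C pdC J] by auto
  then obtain S where S: "S \<in> carrier_mat n n" "pos_def S" "S * S = E"
    using Suc.IH[OF E] by auto
  define s where "s = complex_of_real (sqrt (Re l))"
  have s: "0 < s" "s * s = l"
    using \<open>0 < l\<close> by (auto simp: s_def less_complex_def complex_eq_iff)
  define F where "F = four_block_mat (mat 1 1 (\<lambda>_. s)) (0\<^sub>m 1 n) (0\<^sub>m n 1) S"
  have F: "F \<in> carrier_mat (Suc n) (Suc n)" using S by (simp add: F_def four_block_carrier_mat[of _ 1 1 _ n n, simplified])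
  have pdF: "pos_def F" unfolding F_def
    using pos_def_four_block_diag[OF _ pos_def_single[OF s(1)] S(1,2)] by simp
  have "mat 1 1 (\<lambda>_. s) * mat 1 1 (\<lambda>_. s) = mat 1 1 (\<lambda>_. l)"
    using s by (intro eq_matI) (auto simp: scalar_prod_def)
  then have FF: "F * F = C"
    unfolding F_def Cblock using S by (subst mult_four_block_mat[of _ 1 1 _ n _ n]) auto
  \<comment> \<open>This is U F U^*, written as the congruence by X = U^* to fit
    \<open>pos_def_congruence\<close>.\<close>
  define G where "G = mat_adjoint (mat_adjoint U) * F * mat_adjoint U"
  have "pos_def G" unfolding G_def
  proof (rule pos_def_congruence[OF F pdF])
    show "w = 0\<^sub>v (Suc n)" if "w \<in> carrier_vec (Suc n)" "mat_adjoint U *\<^sub>v w = 0\<^sub>v (Suc n)" for w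
      using left_inverse_imp_inj[OF mat_adjoint_carrier[OF U(1)] U(1) U' that] .
  qed (use U in simp)
  moreover have "G \<in> carrier_mat (Suc n) (Suc n)" using U F by (auto simp: G_def intro!: mult_carrier_mat)
  moreover have "G * G = B"
  proof -
    have dims: "dim_row U = Suc n" "dim_col U = Suc n" "dim_row F = Suc n" "dim_col F = Suc n"
       "dim_row B = Suc n" "dim_col B = Suc n" using U F B by auto
    have "G * G = U * F * (mat_adjoint U * U) * F * mat_adjoint U"
      unfolding G_def by (simp add: assoc_mult_mat_dim dims)
    also have "\<dots> = U * (F * F) * mat_adjoint U"
      using F U by (simp add: U(2) right_mult_one_mat[of _ "Suc n" "Suc n"] assoc_mult_mat_dim dims)
    also have "\<dots> = (U * mat_adjoint U) * B * (U * mat_adjoint U)"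
      unfolding FF C_def by (simp add: assoc_mult_mat_dim dims)
    also have "\<dots> = B" using B by (simp add: U')
    finally show ?thesis .
  qed
  ultimately show ?case by blast
qed

section \<open>Inverse square roots and normalization of columns\<close>

lemma pd_sqrt:
  assumes "B \<in> carrier_mat n n" "pos_def B"
  shows "pd_sqrt B \<in> carrier_mat n n" "pos_def (pd_sqrt B)" "pd_sqrt B * pd_sqrt B = B"
proof -
  obtain S where S: "S \<in> carrier_mat n n" "pos_def S" "S * S = B"
    using pos_def_sqrt_exists[OF assms] by auto
  have "pd_sqrt B = S"
    unfolding pd_sqrt_def
  proof (rule the_equality)
    \<comment> \<open>The description leaves the size of T open. It follows because T is square and
      T T has as many rows as T.\<close>
    fix T assume T: "pos_def T \<and> T * T = B"
    then have "T \<in> carrier_mat n n"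
      using assms(1) by (intro carrier_matI) (auto simp: pos_def_def hermitian_def)
    then show "T = S" using T S pos_def_square_inj by metis
  qed (use S in simp)
  then show "pd_sqrt B \<in> carrier_mat n n" "pos_def (pd_sqrt B)" "pd_sqrt B * pd_sqrt B = B"
    using S by auto
qed

lemma inv_pd_sqrt:
  assumes "B \<in> carrier_mat n n" "pos_def B"
  shows "inv_pd_sqrt B \<in> carrier_mat n n" "inv_pd_sqrt B * pd_sqrt B = 1\<^sub>m n"
    "pd_sqrt B * inv_pd_sqrt B = 1\<^sub>m n"
proof -
  note S = pd_sqrt[OF assms]
  have "pd_sqrt B \<in> Units (ring_mat TYPE(complex) n ())"
    using det_non_zero_imp_unit[OF S(1)] pos_def_det_nonzero[OF S(1,2)] by auto
  then obtain T where "mat_inverse (pd_sqrt B) = Some T"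
    using mat_inverse(1)[OF S(1), of "()"] by (cases "mat_inverse (pd_sqrt B)") auto
  then show "inv_pd_sqrt B \<in> carrier_mat n n" "inv_pd_sqrt B * pd_sqrt B = 1\<^sub>m n"
    "pd_sqrt B * inv_pd_sqrt B = 1\<^sub>m n"
    using mat_inverse(2)[OF S(1)] by (auto simp: inv_pd_sqrt_def)
qed

text \<open>With B = S S the product regroups as (T^* S)(S T), and T^* S is the adjoint of S T =
  I.\<close>

lemma inv_pd_sqrt_congruence:
  assumes B: "B \<in> carrier_mat n n" "pos_def B"
  shows "mat_adjoint (inv_pd_sqrt B) * B * inv_pd_sqrt B = 1\<^sub>m n"
proof -
  define S T where "S = pd_sqrt B" and "T = inv_pd_sqrt B"
  have S: "S \<in> carrier_mat n n" "mat_adjoint S = S" "S * S = B"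
    using pd_sqrt[OF B] by (auto simp: S_def pos_def_carrier_iff)
  have T: "T \<in> carrier_mat n n" "T * S = 1\<^sub>m n" "S * T = 1\<^sub>m n"
    using inv_pd_sqrt[OF B] by (auto simp: S_def T_def)
  have TS: "mat_adjoint T * S = 1\<^sub>m n"
    using mat_adjoint_mult[of S T] S T by simp
  have "mat_adjoint T * B * T = (mat_adjoint T * S) * (S * T)"
    using S(1) T(1) by (auto simp: S(3)[symmetric] assoc_mult_mat_dim)
  also have "\<dots> = 1\<^sub>m n" by (simp add: TS T(3))
  finally show ?thesis by (simp only: T_def)
qed

text \<open>Normalising the columns of \<open>Q\<close> with respect to \<open>M\<close> does not change their span,
  as the inverse square root is invertible.\<close>
lemma M_orthonormalization:
  assumes M: "M \<in> carrier_mat n n" "pos_def M"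
    and Q: "Q \<in> carrier_mat n p" "mat_adjoint Q * Q = 1\<^sub>m p"
    and X: "X = Q * inv_pd_sqrt (mat_adjoint Q * M * Q)"
  shows "X \<in> carrier_mat n p" "mat_adjoint X * M * X = 1\<^sub>m p"
    "\<exists>T \<in> carrier_mat p p. X = Q * T" "\<exists>S \<in> carrier_mat p p. Q = X * S"
proof -
  define B where "B = mat_adjoint Q * M * Q"
  have B: "B \<in> carrier_mat p p" using M Q by (auto simp: B_def intro!: mult_carrier_mat)
  have pd: "pos_def B"
    unfolding B_def
    using pos_def_congruence[OF M Q(1) left_inverse_imp_inj[OF Q(1) mat_adjoint_carrier[OF Q(1)] Q(2)]] .
  define S T where "S = pd_sqrt B" and "T = inv_pd_sqrt B"
  have S: "S \<in> carrier_mat p p" using pd_sqrt[OF B pd] by (simp add: S_def)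
  have T: "T \<in> carrier_mat p p" "T * S = 1\<^sub>m p"
    using inv_pd_sqrt[OF B pd] by (auto simp: S_def T_def)
  have X': "X = Q * T" by (simp add: X T_def B_def)
  show "X \<in> carrier_mat n p" using Q T by (simp add: X')
  show "\<exists>T \<in> carrier_mat p p. X = Q * T" using T X' by blast
  have "X * S = Q" using Q S T by (auto simp: X' assoc_mult_mat_dim[of Q T S])
  then show "\<exists>S \<in> carrier_mat p p. Q = X * S" using S by blast
  have "mat_adjoint X * M * X = mat_adjoint T * B * T"
    using Q S T M by (auto simp: X' B_def assoc_mult_mat_dim mat_adjoint_mult)
  then show "mat_adjoint X * M * X = 1\<^sub>m p"
    using inv_pd_sqrt_congruence[OF B pd] by (simp add: T_def)
qed

section \<open>Block matrices\<close>

lemma append_cols_carrier [simp]: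
  "A \<in> carrier_mat n k \<Longrightarrow> B \<in> carrier_mat n m \<Longrightarrow> A @\<^sub>c B \<in> carrier_mat n (k + m)"
  by (auto simp: append_cols_def)

lemma mat_adjoint_append_cols:
  "A \<in> carrier_mat n k \<Longrightarrow> B \<in> carrier_mat n m \<Longrightarrow> mat_adjoint (A @\<^sub>c B) = mat_adjoint A @\<^sub>r mat_adjoint B"
  unfolding append_cols_def append_rows_def
  by (subst mat_adjoint_four_block[of _ n k _ m _ 0]) auto

lemma append_cols_mult_vec:
  assumes A: "A \<in> carrier_mat n k" and B: "B \<in> carrier_mat n m"
    and a: "a \<in> carrier_vec k" and b: "b \<in> carrier_vec m"
  shows "(A @\<^sub>c B) *\<^sub>v (a @\<^sub>v b) = A *\<^sub>v a + B *\<^sub>v b"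
proof -
  \<comment> \<open>The second part of the stacked vector has length 0: it comes from the empty
    lower blocks that encode \<open>append_cols\<close>.\<close>
  have "(A @\<^sub>c B) *\<^sub>v (a @\<^sub>v b) = (A *\<^sub>v a + B *\<^sub>v b) @\<^sub>v (0\<^sub>m 0 k *\<^sub>v a + 0\<^sub>m 0 m *\<^sub>v b)"
    using four_block_mat_mult_vec[OF A B _ _ a b, of "0\<^sub>m 0 k" 0 "0\<^sub>m 0 m"] A B by (simp add: append_cols_def)
  also have "\<dots> = A *\<^sub>v a + B *\<^sub>v b"
    by (intro eq_vecI) auto
  finally show ?thesis .
qed

lemma append_rows_mult:
  fixes A B C :: "complex mat"
  assumes "A \<in> carrier_mat k n" "B \<in> carrier_mat m n" "C \<in> carrier_mat n l"
  shows "(A @\<^sub>r B) * C = (A * C) @\<^sub>r (B * C)"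
proof (rule eq_matI)
  fix i j assume "i < dim_row ((A * C) @\<^sub>r (B * C))" "j < dim_col ((A * C) @\<^sub>r (B * C))"
  then have ij: "i < k + m" "j < l" using assms by (auto simp: append_rows_def)
  have "row (A @\<^sub>r B) i = (if i < k then row A i else row B (i - k))"
    using ij assms by (intro eq_vecI) (auto simp: append_rows_def)
  then show "((A @\<^sub>r B) * C) $$ (i, j) = ((A * C) @\<^sub>r (B * C)) $$ (i, j)"
    using ij assms by (auto simp: append_rows_def)
qed (use assms in \<open>auto simp: append_rows_def\<close>)

lemma append_rows_mult_append_cols:
  fixes A B C D :: "complex mat"
  assumes "A \<in> carrier_mat k n" "B \<in> carrier_mat m n" "C \<in> carrier_mat n k'" "D \<in> carrier_mat n m'"
  shows "(A @\<^sub>r B) * (C @\<^sub>c D) = four_block_mat (A * C) (A * D) (B * C) (B * D)"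
  using assms unfolding append_cols_def append_rows_def
  by (subst mult_four_block_mat[of _ k n _ 0 _ m _ _ k' _ m']) auto

lemma append_cols_mult_append_rows:
  fixes A B C D :: "complex mat"
  assumes "A \<in> carrier_mat n k" "B \<in> carrier_mat n m" "C \<in> carrier_mat k l" "D \<in> carrier_mat m l"
  shows "(A @\<^sub>c B) * (C @\<^sub>r D) = A * C + B * D"
  using assms unfolding append_cols_def append_rows_def
  by (subst mult_four_block_mat[of _ n k _ m _ 0 _ _ l _ 0]) (auto intro!: eq_matI)

lemma append_rows_inject:
  fixes A B C D :: "complex mat"
  assumes "A \<in> carrier_mat n k" "B \<in> carrier_mat m k" "C \<in> carrier_mat n k" "D \<in> carrier_mat m k"
    and "A @\<^sub>r B = C @\<^sub>r D"
  shows "A = C" "B = D"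
proof -
  have e: "(A @\<^sub>r B) $$ (i, j) = (C @\<^sub>r D) $$ (i, j)" for i j using assms(5) by simp
  show "A = C"
  proof (rule eq_matI)
    fix i j assume "i < dim_row C" "j < dim_col C"
    then show "A $$ (i, j) = C $$ (i, j)"
      using e[of i j] assms(1-4) by (auto simp: append_rows_def)
  qed (use assms in auto)
  show "B = D"
  proof (rule eq_matI)
    fix i j assume "i < dim_row D" "j < dim_col D"
    then show "B $$ (i, j) = D $$ (i, j)"
      using e[of "n + i" j] assms(1-4) by (auto simp: append_rows_def)
  qed (use assms in auto)
qed

lemma four_block_mat_eq_one:
  fixes A B C D :: "complex mat"
  assumes c: "A \<in> carrier_mat n n" "D \<in> carrier_mat m m"
    and "four_block_mat A B C D = 1\<^sub>m (n + m)"
  shows "A = 1\<^sub>m n" "D = 1\<^sub>m m"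
proof -
  have e: "four_block_mat A B C D $$ (i, j) = (if i = j then 1 else 0)" if "i < n + m" "j < n + m" for i j
    using assms(3) that by simp
  show "A = 1\<^sub>m n"
  proof (rule eq_matI)
    fix i j assume "i < dim_row (1\<^sub>m n :: complex mat)" "j < dim_col (1\<^sub>m n :: complex mat)"
    then show "A $$ (i, j) = 1\<^sub>m n $$ (i, j)" using e[of i j] c by auto
  qed (use c in auto)
  show "D = 1\<^sub>m m"
  proof (rule eq_matI)
    fix i j assume "i < dim_row (1\<^sub>m m :: complex mat)" "j < dim_col (1\<^sub>m m :: complex mat)"
    then show "D $$ (i, j) = 1\<^sub>m m $$ (i, j)" using e[of "n + i" "n + j"] c by auto
  qed (use c in auto)
qed

text \<open>The first two equations are the diagonal blocks of Q^* Q = I. The third is Q Q^* = I,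
  valid because Q is square; it splits every vector into a part in the range of \<open>Q1\<close>
  and a part in the range of \<open>Q2\<close>.\<close>

lemma unitary_append_cols:
  assumes Q: "Q1 \<in> carrier_mat n k" "Q2 \<in> carrier_mat n m" and n: "k + m = n"
    and U: "unitary (Q1 @\<^sub>c Q2)"
  shows "mat_adjoint Q1 * Q1 = 1\<^sub>m k" "mat_adjoint Q2 * Q2 = 1\<^sub>m m"
    "Q1 * mat_adjoint Q1 + Q2 * mat_adjoint Q2 = 1\<^sub>m n"
proof -
  have c: "Q1 @\<^sub>c Q2 \<in> carrier_mat n n" using append_cols_carrier[OF Q] n by simp
  then have one: "mat_adjoint (Q1 @\<^sub>c Q2) * (Q1 @\<^sub>c Q2) = 1\<^sub>m n" using U by (auto simp: unitary_def)
  then have "four_block_mat (mat_adjoint Q1 * Q1) (mat_adjoint Q1 * Q2) (mat_adjoint Q2 * Q1) (mat_adjoint Q2 * Q2) = 1\<^sub>m (k + m)"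
    unfolding mat_adjoint_append_cols[OF Q] n
    by (subst (asm) append_rows_mult_append_cols[of _ k n _ m _ k _ m]) (use Q in auto)
  then show "mat_adjoint Q1 * Q1 = 1\<^sub>m k" "mat_adjoint Q2 * Q2 = 1\<^sub>m m"
    using four_block_mat_eq_one[OF mult_carrier_mat[OF mat_adjoint_carrier[OF Q(1)] Q(1)]
        mult_carrier_mat[OF mat_adjoint_carrier[OF Q(2)] Q(2)]] by blast+
  have "(Q1 @\<^sub>c Q2) * mat_adjoint (Q1 @\<^sub>c Q2) = 1\<^sub>m n"
    using mat_mult_left_right_inverse[OF mat_adjoint_carrier[OF c] c one] .
  then show "Q1 * mat_adjoint Q1 + Q2 * mat_adjoint Q2 = 1\<^sub>m n"
    using append_cols_mult_append_rows[of Q1 n k Q2 m "mat_adjoint Q1" n "mat_adjoint Q2"] Q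
    by (simp add: mat_adjoint_append_cols[OF Q])
qed

text \<open>The zero block of a QR factorization says that the columns of \<open>Q2\<close> are
  orthogonal to those of \<open>A\<close>. It serves for \<open>N\<close> and again for
  \<open>M * X2\<close>.\<close>

lemma unitary_append_cols_mult_eq:
  assumes Q: "Q1 \<in> carrier_mat n k" "Q2 \<in> carrier_mat n m" and n: "k + m = n"
    and A: "A \<in> carrier_mat n l" and R: "R \<in> carrier_mat k l"
    and eq: "mat_adjoint (Q1 @\<^sub>c Q2) * A = R @\<^sub>r 0\<^sub>m m l"
  shows "mat_adjoint Q1 * A = R" "mat_adjoint Q2 * A = 0\<^sub>m m l"
proof -
  have "(mat_adjoint Q1 * A) @\<^sub>r (mat_adjoint Q2 * A) = R @\<^sub>r 0\<^sub>m m l"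
    using append_rows_mult[of "mat_adjoint Q1" k n "mat_adjoint Q2" m A l] Q A eq
    by (simp add: mat_adjoint_append_cols[OF Q])
  then show "mat_adjoint Q1 * A = R" "mat_adjoint Q2 * A = 0\<^sub>m m l"
    using append_rows_inject[OF mult_carrier_mat[OF mat_adjoint_carrier[OF Q(1)] A]
        mult_carrier_mat[OF mat_adjoint_carrier[OF Q(2)] A] R zero_carrier_mat] by blast+
qed

lemma pos_def_add_pos_semidef:
  assumes A: "A \<in> carrier_mat n n" "pos_def A" and B: "B \<in> carrier_mat n n" "pos_semidef B"
  shows "pos_def (A + B)"
proof -
  have "0 < ((A + B) *\<^sub>v v) \<bullet>c v" if v: "v \<in> carrier_vec n" "v \<noteq> 0\<^sub>v n" for v
  proof -
    have "((A + B) *\<^sub>v v) \<bullet>c v = (A *\<^sub>v v) \<bullet>c v + (B *\<^sub>v v) \<bullet>c v"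
      using A B v by (simp add: add_mult_distrib_mat_vec[of _ n n] add_scalar_prod_distrib[of _ n])
    then show ?thesis
      using A B v by (auto simp: pos_def_carrier_iff pos_semidef_carrier_iff intro: add_pos_nonneg)
  qed
  then show ?thesis
    using A B mat_adjoint_add[of A n n B] pos_def_carrier_iff[of "A + B" n]
    by (auto simp: pos_def_carrier_iff pos_semidef_carrier_iff)
qed

lemma smult_mat_mult_vec:
  "A \<in> carrier_mat n m \<Longrightarrow> v \<in> carrier_vec m \<Longrightarrow> (k \<cdot>\<^sub>m A) *\<^sub>v v = k \<cdot>\<^sub>v (A *\<^sub>v v)"
  for k :: "'a :: comm_ring_1"
  by (intro eq_vecI) auto

lemma smult_zero_vec: "k \<cdot>\<^sub>v 0\<^sub>v n = 0\<^sub>v n" for k :: "'a :: comm_ring_1"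
  by (intro eq_vecI) auto

lemma mat_adjoint_append_cols_kernel_iff:
  assumes "A \<in> carrier_mat n k" "B \<in> carrier_mat n m" "v \<in> carrier_vec n"
  shows "mat_adjoint (A @\<^sub>c B) *\<^sub>v v = 0\<^sub>v (k + m) \<longleftrightarrow>
    mat_adjoint A *\<^sub>v v = 0\<^sub>v k \<and> mat_adjoint B *\<^sub>v v = 0\<^sub>v m"
proof -
  have "mat_adjoint (A @\<^sub>c B) *\<^sub>v v = (mat_adjoint A *\<^sub>v v) @\<^sub>v (mat_adjoint B *\<^sub>v v)"
    using assms mat_mult_append[of "mat_adjoint A" k n "mat_adjoint B" m v] by (simp add: mat_adjoint_append_cols)
  moreover have "0\<^sub>v (k + m) = 0\<^sub>v k @\<^sub>v (0\<^sub>v m :: complex vec)" by auto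
  moreover have "mat_adjoint A *\<^sub>v v \<in> carrier_vec k"
    using mult_mat_vec_carrier[OF mat_adjoint_carrier[OF assms(1)] assms(3)] .
  ultimately show ?thesis
    using append_vec_eq[of "mat_adjoint A *\<^sub>v v" k "0\<^sub>v k" "mat_adjoint B *\<^sub>v v" "0\<^sub>v m"] by simp
qed

lemma congruence_append_cols:
  fixes A X1 X2 :: "complex mat"
  assumes A: "A \<in> carrier_mat n n" and X: "X1 \<in> carrier_mat n k" "X2 \<in> carrier_mat n m"
  shows "mat_adjoint (X1 @\<^sub>c X2) * A * (X1 @\<^sub>c X2) =
    four_block_mat (mat_adjoint X1 * A * X1) (mat_adjoint X1 * A * X2)
      (mat_adjoint X2 * A * X1) (mat_adjoint X2 * A * X2)"
proof -
  note X' = mat_adjoint_carrier[OF X(1)] mat_adjoint_carrier[OF X(2)]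
  have "mat_adjoint (X1 @\<^sub>c X2) * A = (mat_adjoint X1 * A) @\<^sub>r (mat_adjoint X2 * A)"
    using append_rows_mult[OF X' A] by (simp add: mat_adjoint_append_cols[OF X])
  then show ?thesis
    using append_rows_mult_append_cols[OF mult_carrier_mat[OF X'(1) A] mult_carrier_mat[OF X'(2) A] X] by simp
qed

lemma diag_block_mat_pair: "diag_block_mat [A, B] =
    four_block_mat A (0\<^sub>m (dim_row A) (dim_col B)) (0\<^sub>m (dim_row B) (dim_col A)) B"
  by (rule eq_matI) (auto simp: Let_def)

section \<open>The damped system\<close>

locale damped_system =
  fixes n :: nat and M D K :: "complex mat" and \<omega> :: real
  assumes M: "M \<in> carrier_mat n n" "pos_def M"
    and D: "D \<in> carrier_mat n n" "pos_semidef D"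
    and K: "K \<in> carrier_mat n n" "pos_semidef K"
    and \<omega>: "\<omega> \<noteq> 0"
begin

definition P :: "complex \<Rightarrow> complex mat" where "P z = z\<^sup>2 \<cdot>\<^sub>m M + z \<cdot>\<^sub>m D + K"

definition P0 :: "complex \<Rightarrow> complex mat" where "P0 z = z\<^sup>2 \<cdot>\<^sub>m M + K"

definition i\<omega> :: complex where "i\<omega> = \<i> * complex_of_real \<omega>"

definition N :: "complex mat" where "N = P0 i\<omega> @\<^sub>c D"

lemma adjoint_coeffs: "mat_adjoint M = M" "mat_adjoint D = D" "mat_adjoint K = K"
  using M D K by (auto simp: pos_def_carrier_iff pos_semidef_carrier_iff)

lemma P_carrier: "P z \<in> carrier_mat n n" and P0_carrier: "P0 z \<in> carrier_mat n n"
  using M D K by (auto simp: P_def P0_def)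

lemma N_carrier: "N \<in> carrier_mat n (2 * n)"
  using append_cols_carrier[OF P0_carrier D(1)] by (simp add: N_def mult_2)

lemma P_eq_P0: "P z = P0 z + z \<cdot>\<^sub>m D"
  using M D K by (intro eq_matI) (auto simp: P_def P0_def)

lemma adjoint_P: "mat_adjoint (P z) = P (cnj z)"
  using M D K by (simp add: P_def mat_adjoint_add[of _ n n] mat_adjoint_smult adjoint_coeffs)

lemma i\<omega>_square: "i\<omega>\<^sup>2 = - (complex_of_real \<omega>)\<^sup>2"
  by (simp add: i\<omega>_def power_mult_distrib)

lemma adjoint_P0: "mat_adjoint (P0 i\<omega>) = P0 i\<omega>"
  using M K by (simp add: P0_def mat_adjoint_add[of _ n n] mat_adjoint_smult adjoint_coeffs i\<omega>_square)

text \<open>At the positive point 1 all coefficients enter with positive weight, so 1 witnesses that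
  both polynomials are regular.\<close>

lemma P_1_pos_def: "pos_def (P 1)" and P0_1_pos_def: "pos_def (P0 1)"
proof -
  have "P0 1 = M + K" using M K by (intro eq_matI) (auto simp: P0_def)
  then show *: "pos_def (P0 1)" using pos_def_add_pos_semidef[OF M K] by simp
  have "P 1 = P0 1 + D" using M D K by (intro eq_matI) (auto simp: P_def P0_def)
  then show "pos_def (P 1)" using pos_def_add_pos_semidef[OF P0_carrier * D] by simp
qed

lemma P_mult_vec:
  assumes v: "v \<in> carrier_vec n"
  shows "P z *\<^sub>v v = P0 z *\<^sub>v v + z \<cdot>\<^sub>v (D *\<^sub>v v)"
  using D v P0_carrier[of z]
  by (simp add: P_eq_P0 add_mult_distrib_mat_vec[of _ n n] smult_mat_mult_vec[of _ n n])

lemma P0_mult_vec: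
  assumes v: "v \<in> carrier_vec n"
  shows "P0 z *\<^sub>v v = z\<^sup>2 \<cdot>\<^sub>v (M *\<^sub>v v) + K *\<^sub>v v"
  using M K v
  by (simp add: P0_def add_mult_distrib_mat_vec[of _ n n] smult_mat_mult_vec[of _ n n])

text \<open>The imaginary part of \<open>v\<^sup>* P(\<plusminus>i\<omega>) v\<close> is \<open>\<plusminus>\<omega> v\<^sup>* D v\<close>, so it must vanish on the kernel.\<close>
lemma P_kernel_iff:
  assumes z: "z = i\<omega> \<or> z = - i\<omega>" and v: "v \<in> carrier_vec n"
  shows "P z *\<^sub>v v = 0\<^sub>v n \<longleftrightarrow> P0 i\<omega> *\<^sub>v v = 0\<^sub>v n \<and> D *\<^sub>v v = 0\<^sub>v n"
proof
  \<comment> \<open>This is what lets one proof serve both signs of z.\<close>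
  have "z\<^sup>2 = i\<omega>\<^sup>2" using z by auto
  then have P0z: "P0 z = P0 i\<omega>" by (simp add: P0_def)
  assume Pz: "P z *\<^sub>v v = 0\<^sub>v n"
  have z': "z\<^sup>2 = complex_of_real (- \<omega>\<^sup>2)" "Re z = 0" "Im z \<noteq> 0"
    using z \<omega> i\<omega>_square by (auto simp: i\<omega>_def)
  have "0 = (P z *\<^sub>v v) \<bullet>c v" using v Pz by simp
  also have "\<dots> = z\<^sup>2 * ((M *\<^sub>v v) \<bullet>c v) + (K *\<^sub>v v) \<bullet>c v + z * ((D *\<^sub>v v) \<bullet>c v)"
    using M D K v by (simp add: P_mult_vec P0_mult_vec add_scalar_prod_distrib[of _ n])
  finally have eq: "z\<^sup>2 * ((M *\<^sub>v v) \<bullet>c v) + (K *\<^sub>v v) \<bullet>c v + z * ((D *\<^sub>v v) \<bullet>c v) = 0" by simp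
  have "0 \<le> (M *\<^sub>v v) \<bullet>c v" "0 \<le> (K *\<^sub>v v) \<bullet>c v" "0 \<le> (D *\<^sub>v v) \<bullet>c v"
    using pos_def_imp_pos_semidef[OF M(2)] M D K v by (auto simp: pos_semidef_carrier_iff)
  then have "Im ((M *\<^sub>v v) \<bullet>c v) = 0" "Im ((K *\<^sub>v v) \<bullet>c v) = 0" "Im ((D *\<^sub>v v) \<bullet>c v) = 0"
    by (auto simp: less_eq_complex_def)
  then have "Im z * Re ((D *\<^sub>v v) \<bullet>c v) = 0" "Im ((D *\<^sub>v v) \<bullet>c v) = 0"
    using arg_cong[OF eq, of Im] z' by (simp_all del: of_real_minus of_real_power)
  then have "(D *\<^sub>v v) \<bullet>c v = 0" using z' by (simp add: complex_eq_iff)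
  then have Dv: "D *\<^sub>v v = 0\<^sub>v n" using pos_semidef_form_eq_0[OF D v] by simp
  then have "P z *\<^sub>v v = P0 i\<omega> *\<^sub>v v"
    using P0_carrier[of i\<omega>] v by (simp add: P_mult_vec P0z smult_zero_vec)
  then show "P0 i\<omega> *\<^sub>v v = 0\<^sub>v n \<and> D *\<^sub>v v = 0\<^sub>v n" using Pz Dv by simp
next
  have "z\<^sup>2 = i\<omega>\<^sup>2" using z by auto
  then have P0z: "P0 z = P0 i\<omega>" by (simp add: P0_def)
  assume "P0 i\<omega> *\<^sub>v v = 0\<^sub>v n \<and> D *\<^sub>v v = 0\<^sub>v n"
  then show "P z *\<^sub>v v = 0\<^sub>v n" using v by (simp add: P_mult_vec P0z smult_zero_vec)
qed

lemma P_kernel: "mat_kernel (P i\<omega>) = mat_kernel (P0 i\<omega>) \<inter> mat_kernel D"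
  unfolding mat_kernel[OF P_carrier] mat_kernel[OF P0_carrier] mat_kernel[OF D(1)]
  using P_kernel_iff[OF disjI1[OF refl]] by blast

lemma N_kernel_iff:
  assumes v: "v \<in> carrier_vec n"
  shows "mat_adjoint N *\<^sub>v v = 0\<^sub>v (2 * n) \<longleftrightarrow> P i\<omega> *\<^sub>v v = 0\<^sub>v n"
  unfolding N_def mult_2 mat_adjoint_append_cols_kernel_iff[OF P0_carrier D(1) v] adjoint_P0 adjoint_coeffs
  by (rule P_kernel_iff[OF disjI1[OF refl] v, symmetric])

lemma rank_plus_geom_mult: "vec_space.rank n N + geom_mult P i\<omega> = n"
proof -
  have "mat_kernel (mat_adjoint N) = mat_kernel (P i\<omega>)"
    using N_kernel_iff by (auto simp: mat_kernel[OF mat_adjoint_carrier[OF N_carrier]] mat_kernel[OF P_carrier])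
  then have "kernel_dim (mat_adjoint N) = kernel_dim (P i\<omega>)"
    using P_carrier N_carrier by (simp add: kernel_dim_def carrier_matD[OF P_carrier] carrier_matD[OF N_carrier])
  then show ?thesis
    using rank_plus_adjoint_kernel_dim[OF N_carrier] by (simp add: geom_mult_def)
qed

lemma eigenvalue_iff_rank: "det (P i\<omega>) = 0 \<longleftrightarrow> vec_space.rank n N < n"
proof -
  have "det (P i\<omega>) = 0 \<longleftrightarrow> vec_space.rank n (P i\<omega>) \<noteq> n"
    using vec_space.det_rank_iff[OF P_carrier] by blast
  also have "\<dots> \<longleftrightarrow> geom_mult P i\<omega> \<noteq> 0"
    using rank_nullity[OF P_carrier[of i\<omega>]] unfolding geom_mult_def by linarith
  also have "\<dots> \<longleftrightarrow> vec_space.rank n N < n" using rank_plus_geom_mult by linarith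
  finally show ?thesis .
qed

lemma eigenvalue_imp_undamped:
  assumes "det (P i\<omega>) = 0"
  shows "det (P0 i\<omega>) = 0"
proof -
  obtain v where v: "v \<in> carrier_vec n" "v \<noteq> 0\<^sub>v n" "P i\<omega> *\<^sub>v v = 0\<^sub>v n"
    using assms unfolding det_0_iff_vec_prod_zero_field[OF P_carrier] by blast
  then have "P0 i\<omega> *\<^sub>v v = 0\<^sub>v n"
    using P_kernel_iff[of i\<omega> v] by simp
  then show ?thesis
    using v unfolding det_0_iff_vec_prod_zero_field[OF P0_carrier] by blast
qed

text \<open>Taking adjoints gives N^* X = 0, whose two block rows are the claims, as both blocks of
  \<open>N\<close> are self-adjoint.\<close>

lemma mult_by_kernel:
  assumes X: "X \<in> carrier_mat n p" and zero: "mat_adjoint X * N = 0\<^sub>m p (2 * n)"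
  shows "P0 i\<omega> * X = 0\<^sub>m n p" "D * X = 0\<^sub>m n p"
proof -
  have "mat_adjoint N * X = mat_adjoint (mat_adjoint X * N)"
    using X N_carrier by (auto simp: mat_adjoint_mult)
  then have "mat_adjoint N * X = 0\<^sub>m (2 * n) p" by (simp add: zero)
  moreover have "mat_adjoint N * X = (P0 i\<omega> * X) @\<^sub>r (D * X)"
    using append_rows_mult[OF P0_carrier D(1) X, of i\<omega>]
    by (simp add: N_def mat_adjoint_append_cols[OF P0_carrier D(1)] adjoint_P0 adjoint_coeffs)
  moreover have "0\<^sub>m (2 * n) p = 0\<^sub>m n p @\<^sub>r (0\<^sub>m n p :: complex mat)"
    by (rule eq_matI) (auto simp: append_rows_def)
  ultimately have "(P0 i\<omega> * X) @\<^sub>r (D * X) = 0\<^sub>m n p @\<^sub>r 0\<^sub>m n p" by simp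
  then show "P0 i\<omega> * X = 0\<^sub>m n p" "D * X = 0\<^sub>m n p"
    using append_rows_inject[OF mult_carrier_mat[OF P0_carrier X] mult_carrier_mat[OF D(1) X]
        zero_carrier_mat zero_carrier_mat] by blast+
qed

text \<open>Since K = P0(i\<omega>) + \<omega>^2 M, one can write P(z) = P0(i\<omega>) + (z^2 +
  \<omega>^2) M + z D. The outer terms annihilate X.\<close>

lemma P_mult_kernel:
  assumes X: "X \<in> carrier_mat n p" and "P0 i\<omega> * X = 0\<^sub>m n p" "D * X = 0\<^sub>m n p"
  shows "P z * X = (z\<^sup>2 + (complex_of_real \<omega>)\<^sup>2) \<cdot>\<^sub>m (M * X)"
proof -
  have "P z = P0 i\<omega> + (z\<^sup>2 + (complex_of_real \<omega>)\<^sup>2) \<cdot>\<^sub>m M + z \<cdot>\<^sub>m D"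
    using M D K by (intro eq_matI) (auto simp: P_def P0_def i\<omega>_square algebra_simps)
  also have "\<dots> * X = P0 i\<omega> * X + ((z\<^sup>2 + (complex_of_real \<omega>)\<^sup>2) \<cdot>\<^sub>m (M * X) + z \<cdot>\<^sub>m (D * X))"
    using M D X P0_carrier[of i\<omega>]
    by (simp add: add_mult_distrib_mat[of _ n n] mult_smult_assoc_mat[of _ n n])
  also have "\<dots> = (z\<^sup>2 + (complex_of_real \<omega>)\<^sup>2) \<cdot>\<^sub>m (M * X)"
    using M X by (intro eq_matI) (auto simp: assms(2,3))
  finally show ?thesis .
qed

text \<open>With \<open>Q\<^sub>1 R = N\<close> and \<open>R\<close> of full row rank, \<open>N\<^sup>* v = R\<^sup>* Q\<^sub>1\<^sup>* v\<close>
  vanishes only if \<open>Q\<^sub>1\<^sup>* v\<close> does, i.e. if \<open>v = Q\<^sub>2 Q\<^sub>2\<^sup>* v\<close>.\<close>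
lemma col_space_eq_kernel:
  assumes p: "p \<le> n"
    and Q: "Q1 \<in> carrier_mat n (n - p)" "Q2 \<in> carrier_mat n p" "unitary (Q1 @\<^sub>c Q2)"
    and R: "R \<in> carrier_mat (n - p) (2 * n)" "vec_space.rank (n - p) R = n - p"
    and QN: "mat_adjoint (Q1 @\<^sub>c Q2) * N = R @\<^sub>r 0\<^sub>m p (2 * n)"
  shows "vec_space.col_space n Q2 = mat_kernel (P i\<omega>)"
proof -
  interpret W: vec_space "TYPE(complex)" n .
  have np: "n - p + p = n" using p by simp
  note U = unitary_append_cols[OF Q(1,2) np Q(3)]
  note E = unitary_append_cols_mult_eq[OF Q(1,2) np N_carrier R(1) QN]
  note Q2 = mult_by_kernel[OF Q(2) E(2)]
  have "P i\<omega> *\<^sub>v (Q2 *\<^sub>v x) = 0\<^sub>v n" if x: "x \<in> carrier_vec p" for x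
  proof -
    have "(P0 i\<omega> * Q2) *\<^sub>v x = 0\<^sub>v n" "(D * Q2) *\<^sub>v x = 0\<^sub>v n"
      unfolding Q2 using x by auto
    then show ?thesis
      using P_kernel_iff[of i\<omega> "Q2 *\<^sub>v x"] mult_mat_vec_carrier[OF Q(2) x]
        assoc_mult_mat_vec[OF P0_carrier Q(2) x] assoc_mult_mat_vec[OF D(1) Q(2) x] by simp
  qed
  moreover have "\<exists>x \<in> carrier_vec p. v = Q2 *\<^sub>v x" if v: "v \<in> carrier_vec n" "P i\<omega> *\<^sub>v v = 0\<^sub>v n" for v
  proof -
    define u where "u = mat_adjoint Q1 *\<^sub>v v"
    define x where "x = mat_adjoint Q2 *\<^sub>v v"
    have u: "u \<in> carrier_vec (n - p)" and x: "x \<in> carrier_vec p"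
      using Q v by (auto simp: u_def x_def intro!: mult_mat_vec_carrier[OF mat_adjoint_carrier])
    have decomp: "v = Q1 *\<^sub>v u + Q2 *\<^sub>v x"
    proof -
      have "v = (Q1 * mat_adjoint Q1 + Q2 * mat_adjoint Q2) *\<^sub>v v"
        using v by (simp add: U(3))
      also have "\<dots> = Q1 *\<^sub>v u + Q2 *\<^sub>v x"
        using add_mult_distrib_mat_vec[OF mult_carrier_mat[OF Q(1) mat_adjoint_carrier[OF Q(1)]]
            mult_carrier_mat[OF Q(2) mat_adjoint_carrier[OF Q(2)]] v(1)] 
        by (simp add: u_def x_def assoc_mult_mat_vec[OF Q(1) mat_adjoint_carrier[OF Q(1)] v(1)]
            assoc_mult_mat_vec[OF Q(2) mat_adjoint_carrier[OF Q(2)] v(1)])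
      finally show ?thesis .
    qed
    have "N = Q1 * R"
    proof -
      have "N = (Q1 * mat_adjoint Q1 + Q2 * mat_adjoint Q2) * N"
        using N_carrier by (simp add: U(3))
      also have "\<dots> = Q1 * (mat_adjoint Q1 * N) + Q2 * (mat_adjoint Q2 * N)"
        using add_mult_distrib_mat[OF mult_carrier_mat[OF Q(1) mat_adjoint_carrier[OF Q(1)]]
            mult_carrier_mat[OF Q(2) mat_adjoint_carrier[OF Q(2)]] N_carrier]
        by (simp add: assoc_mult_mat[OF Q(1) mat_adjoint_carrier[OF Q(1)] N_carrier]
            assoc_mult_mat[OF Q(2) mat_adjoint_carrier[OF Q(2)] N_carrier])
      also have "\<dots> = Q1 * R"
        using mult_carrier_mat[OF Q(1) R(1)] Q(2) by (simp add: E)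
      finally show ?thesis .
    qed
    then have "mat_adjoint N *\<^sub>v v = mat_adjoint R *\<^sub>v u"
      using Q R v by (auto simp: mat_adjoint_mult assoc_mult_mat_vec_dim u_def)
    then have "mat_adjoint R *\<^sub>v u = 0\<^sub>v (2 * n)"
      using N_kernel_iff[OF v(1)] v(2) by simp
    moreover have "kernel_dim (mat_adjoint R) = 0"
      using rank_plus_adjoint_kernel_dim[OF R(1)] R(2) by simp
    ultimately have "u = 0\<^sub>v (n - p)"
      using kernel_dim_zero_imp_trivial[OF mat_adjoint_carrier[OF R(1)] _ u] by simp
    then have "Q1 *\<^sub>v u = 0\<^sub>v n" using Q(1) by (intro eq_vecI) (auto simp: scalar_prod_def)
    then have "v = Q2 *\<^sub>v x" using decomp mult_mat_vec_carrier[OF Q(2) x] by simp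
    then show ?thesis using x by blast
  qed
  ultimately show ?thesis
    using mult_mat_vec_carrier[OF Q(2)] carrier_matD[OF Q(2)]
    by (auto simp: W.col_space_eq[OF Q(2)] mat_kernel[OF P_carrier])
qed

section \<open>Block diagonalization and the spectrum of the deflated block\<close>

lemma block_diagonalization:
  assumes p: "p \<le> n"
    and X1: "X1 \<in> carrier_mat n (n - p)" "mat_adjoint X1 * M * X1 = 1\<^sub>m (n - p)"
    and X2: "X2 \<in> carrier_mat n p" "mat_adjoint X2 * M * X2 = 1\<^sub>m p"
    and orth: "mat_adjoint X1 * M * X2 = 0\<^sub>m (n - p) p"
    and ker: "P0 i\<omega> * X2 = 0\<^sub>m n p" "D * X2 = 0\<^sub>m n p"
  defines "X \<equiv> X1 @\<^sub>c X2"
  shows "mat_adjoint X * M * X = 1\<^sub>m n"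
    "mat_adjoint X * P z * X =
      four_block_mat (mat_adjoint X1 * P z * X1) (0\<^sub>m (n - p) p) (0\<^sub>m p (n - p))
        ((z\<^sup>2 + (complex_of_real \<omega>)\<^sup>2) \<cdot>\<^sub>m 1\<^sub>m p)"
proof -
  note X1' = mat_adjoint_carrier[OF X1(1)] and X2' = mat_adjoint_carrier[OF X2(1)]
  have np: "n - p + p = n" using p by simp
  have swap: "mat_adjoint X2 * A * X1 = mat_adjoint (mat_adjoint X1 * mat_adjoint A * X2)"
    if "A \<in> carrier_mat n n" for A
    using X1 X2 that by (auto simp: mat_adjoint_mult assoc_mult_mat_dim)
  have "mat_adjoint X2 * M * X1 = 0\<^sub>m p (n - p)"
    by (simp add: swap[OF M(1)] adjoint_coeffs orth)
  then show "mat_adjoint X * M * X = 1\<^sub>m n"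
    unfolding X_def congruence_append_cols[OF M(1) X1(1) X2(1)] by (simp add: X1 X2 orth np)
  \<comment> \<open>Y = X1 will give the vanishing upper right block, Y = X2 the scalar lower right
    one.\<close>
  have PX2: "mat_adjoint Y * P w * X2 = (w\<^sup>2 + (complex_of_real \<omega>)\<^sup>2) \<cdot>\<^sub>m (mat_adjoint Y * M * X2)"
    if Y: "Y \<in> carrier_mat n k" for Y k w
  proof -
    note Y' = mat_adjoint_carrier[OF Y]
    have "mat_adjoint Y * P w * X2 = mat_adjoint Y * (P w * X2)"
      using assoc_mult_mat[OF Y' P_carrier X2(1)] .
    also have "\<dots> = (w\<^sup>2 + (complex_of_real \<omega>)\<^sup>2) \<cdot>\<^sub>m (mat_adjoint Y * (M * X2))"
      unfolding P_mult_kernel[OF X2(1) ker]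
      using mult_smult_distrib[OF Y' mult_carrier_mat[OF M(1) X2(1)]] .
    also have "mat_adjoint Y * (M * X2) = mat_adjoint Y * M * X2"
      using assoc_mult_mat[OF Y' M(1) X2(1)] by simp
    finally show ?thesis .
  qed
  \<comment> \<open>Stated for every w because the lower left block at z is the adjoint of the upper
    right block at the conjugate of z.\<close>
  have "mat_adjoint X1 * P w * X2 = 0\<^sub>m (n - p) p" for w
    unfolding PX2[OF X1(1)] orth by (intro eq_matI) auto
  moreover from this have "mat_adjoint X2 * P z * X1 = 0\<^sub>m p (n - p)"
    by (simp add: swap[OF P_carrier] adjoint_P)
  ultimately show "mat_adjoint X * P z * X =
      four_block_mat (mat_adjoint X1 * P z * X1) (0\<^sub>m (n - p) p) (0\<^sub>m p (n - p))
        ((z\<^sup>2 + (complex_of_real \<omega>)\<^sup>2) \<cdot>\<^sub>m 1\<^sub>m p)"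
    unfolding X_def congruence_append_cols[OF P_carrier X1(1) X2(1)] by (simp add: PX2[OF X2(1)] X2(2))
qed

lemma square_plus_eq_0_iff: "z\<^sup>2 + (complex_of_real \<omega>)\<^sup>2 = 0 \<longleftrightarrow> z = i\<omega> \<or> z = - i\<omega>"
proof -
  have "z\<^sup>2 + (complex_of_real \<omega>)\<^sup>2 = (z - i\<omega>) * (z + i\<omega>)"
    using i\<omega>_square by (simp add: algebra_simps power2_eq_square)
  then show ?thesis by (auto simp: eq_neg_iff_add_eq_0)
qed

lemma det_P_eq_0_iff:
  assumes p: "p \<le> n" "p \<noteq> 0"
    and X1: "X1 \<in> carrier_mat n (n - p)" "mat_adjoint X1 * M * X1 = 1\<^sub>m (n - p)"
    and X2: "X2 \<in> carrier_mat n p" "mat_adjoint X2 * M * X2 = 1\<^sub>m p"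
    and orth: "mat_adjoint X1 * M * X2 = 0\<^sub>m (n - p) p"
    and ker: "P0 i\<omega> * X2 = 0\<^sub>m n p" "D * X2 = 0\<^sub>m n p"
  shows "det (P z) = 0 \<longleftrightarrow> det (mat_adjoint X1 * P z * X1) = 0 \<or> z = i\<omega> \<or> z = - i\<omega>"
proof -
  define X where "X = X1 @\<^sub>c X2"
  note block = block_diagonalization[OF p(1) X1 X2 orth ker, folded X_def]
  have X: "X \<in> carrier_mat n n" using append_cols_carrier[OF X1(1) X2(1)] p by (simp add: X_def)
  note X' = mat_adjoint_carrier[OF X]
  have det: "det (mat_adjoint X * A * X) = det (mat_adjoint X) * det A * det X" if "A \<in> carrier_mat n n" for A
    using det_mult[OF mult_carrier_mat[OF X' that] X] det_mult[OF X' that] by simp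
  have "det (mat_adjoint X) * det M * det X = 1"
    using det[OF M(1)] block(1) by simp
  then have "det (P z) = 0 \<longleftrightarrow> det (mat_adjoint X * P z * X) = 0"
    using det[OF P_carrier[of z]] by auto
  also have "det (mat_adjoint X * P z * X) =
      det (mat_adjoint X1 * P z * X1) * (z\<^sup>2 + (complex_of_real \<omega>)\<^sup>2) ^ p"
    unfolding block(2)
    by (subst det_four_block_mat_lower_left_zero[of _ "n - p" _ p])
      (auto intro!: mult_carrier_mat[OF mult_carrier_mat[OF mat_adjoint_carrier[OF X1(1)] P_carrier] X1(1)])
  finally show ?thesis using p(2) square_plus_eq_0_iff[of z] by simp
qed

text \<open>A kernel vector \<open>w\<close> of the deflated polynomial at \<open>\<plusminus>i\<omega>\<close> gives a kernel vector \<open>X\<^sub>1 w\<close> of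
  \<open>P(\<plusminus>i\<omega>)\<close>, which lies in the range of \<open>X\<^sub>2\<close> and is therefore \<open>M\<close>-orthogonal to \<open>X\<^sub>1\<close>.\<close>
lemma deflated_det_nonzero:
  assumes p: "p \<le> n"
    and X1: "X1 \<in> carrier_mat n (n - p)" "mat_adjoint X1 * M * X1 = 1\<^sub>m (n - p)"
    and X2: "X2 \<in> carrier_mat n p" "mat_adjoint X2 * M * X2 = 1\<^sub>m p"
    and orth: "mat_adjoint X1 * M * X2 = 0\<^sub>m (n - p) p"
    and ker: "P0 i\<omega> * X2 = 0\<^sub>m n p" "D * X2 = 0\<^sub>m n p"
    and range: "\<And>v. v \<in> mat_kernel (P i\<omega>) \<Longrightarrow> \<exists>x \<in> carrier_vec p. v = X2 *\<^sub>v x"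
    and z: "z = i\<omega> \<or> z = - i\<omega>"
  shows "det (mat_adjoint X1 * P z * X1) \<noteq> 0"
proof
  define X where "X = X1 @\<^sub>c X2"
  note block = block_diagonalization[OF p X1 X2 orth ker, folded X_def]
  have np: "n - p + p = n" using p by simp
  have X: "X \<in> carrier_mat n n" using append_cols_carrier[OF X1(1) X2(1)] np by (simp add: X_def)
  note X' = mat_adjoint_carrier[OF X] and X1' = mat_adjoint_carrier[OF X1(1)]
  have Pt: "mat_adjoint X1 * P z * X1 \<in> carrier_mat (n - p) (n - p)"
    using mult_carrier_mat[OF mult_carrier_mat[OF X1' P_carrier] X1(1)] .
  assume "det (mat_adjoint X1 * P z * X1) = 0"
  then obtain w where w: "w \<in> carrier_vec (n - p)" "w \<noteq> 0\<^sub>v (n - p)" "(mat_adjoint X1 * P z * X1) *\<^sub>v w = 0\<^sub>v (n - p)"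
    using det_0_iff_vec_prod_zero_field[OF Pt] by blast
  define v where "v = X1 *\<^sub>v w"
  have v: "v \<in> carrier_vec n" using X1 w by (auto simp: v_def intro!: mult_mat_vec_carrier)
  have Xw: "X *\<^sub>v (w @\<^sub>v 0\<^sub>v p) = v"
  proof -
    have "X2 *\<^sub>v 0\<^sub>v p = 0\<^sub>v n" using X2(1) by (intro eq_vecI) (auto simp: scalar_prod_def)
    then show ?thesis
      using append_cols_mult_vec[OF X1(1) X2(1) w(1), of "0\<^sub>v p"] v by (simp add: X_def v_def)
  qed
  have wp: "w @\<^sub>v 0\<^sub>v p \<in> carrier_vec n" using w np by (metis append_carrier_vec zero_carrier_vec)
  have "(mat_adjoint X * P z * X) *\<^sub>v (w @\<^sub>v 0\<^sub>v p) = 0\<^sub>v (n - p) @\<^sub>v 0\<^sub>v p"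
    unfolding block(2)
    by (subst four_block_mat_mult_vec[OF Pt _ _ _ w(1), of _ p _ p])
      (use w in \<open>auto simp: smult_zero_vec smult_mat_mult_vec[of _ p p]\<close>)
  also have "\<dots> = 0\<^sub>v n" using np by auto
  finally have "mat_adjoint X *\<^sub>v (P z *\<^sub>v v) = 0\<^sub>v n"
    using assoc_mult_mat_vec[OF mult_carrier_mat[OF X' P_carrier] X wp, of z] 
      assoc_mult_mat_vec[OF X' P_carrier v] by (simp add: Xw)
  moreover have "X * (mat_adjoint X * M) = 1\<^sub>m n"
    using mat_mult_left_right_inverse[OF mult_carrier_mat[OF X' M(1)] X block(1)] .
  \<comment> \<open>M X is a right inverse of the square matrix X^*, hence a left inverse too, so
    X^* can be cancelled.\<close>
  then have "(M * X) * mat_adjoint X = 1\<^sub>m n"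
  proof -
    have "mat_adjoint X * (M * X) = 1\<^sub>m n"
      using block(1) assoc_mult_mat[OF X' M(1) X] by simp
    then show ?thesis
      using mat_mult_left_right_inverse[OF X' mult_carrier_mat[OF M(1) X]] by simp
  qed
  ultimately have "P z *\<^sub>v v = 0\<^sub>v n"
    using left_inverse_imp_inj[OF X' mult_carrier_mat[OF M(1) X]] mult_mat_vec_carrier[OF P_carrier v] by blast
  \<comment> \<open>The hypothesis \<open>range\<close> speaks of i\<omega> alone; the kernel at
    -i\<omega> is the same.\<close>
  then have "P i\<omega> *\<^sub>v v = 0\<^sub>v n" using P_kernel_iff[OF z v] P_kernel_iff[of i\<omega> v] v by simp
  then obtain x where x: "x \<in> carrier_vec p" "v = X2 *\<^sub>v x"
    using range[of v] v by (auto simp: mat_kernel[OF P_carrier])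
  \<comment> \<open>X1^* M is a left inverse of \<open>X1\<close>, so it recovers w from v, yet it
    annihilates the range of \<open>X2\<close>.\<close>
  have "w = (mat_adjoint X1 * M) *\<^sub>v v"
    using assoc_mult_mat_vec[OF mult_carrier_mat[OF X1' M(1)] X1(1) w(1)] w(1) by (simp add: v_def X1(2))
  also have "\<dots> = (mat_adjoint X1 * M * X2) *\<^sub>v x"
    using assoc_mult_mat_vec[OF mult_carrier_mat[OF X1' M(1)] X2(1) x(1)] by (simp add: x(2))
  also have "\<dots> = 0\<^sub>v (n - p)" unfolding orth using x by auto
  finally show False using w(2) by simp
qed

lemma regular_P: "regular P"
  unfolding regular_def using pos_def_det_nonzero[OF P_carrier P_1_pos_def] by (rule exI)

lemma regular_P0: "regular P0"
  unfolding regular_def using pos_def_det_nonzero[OF P0_carrier P0_1_pos_def] by (rule exI)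

lemma rank_N: "mat_rank N = vec_space.rank n N"
  by (simp add: carrier_matD[OF N_carrier])

text \<open>Subtraction of naturals is truncated; p \<le> n makes \<open>n - p\<close> determine
  p.\<close>

lemma geom_mult_eq:
  assumes "p \<le> n" "mat_rank N = n - p"
  shows "geom_mult P i\<omega> = p"
  using rank_plus_geom_mult assms(1) assms(2)[unfolded rank_N] by linarith

lemma qr_factorization_N:
  assumes p: "p \<le> n"
    and Q: "Q1 \<in> carrier_mat n (n - p)" "Q2 \<in> carrier_mat n p"
    and R: "R \<in> carrier_mat (n - p) (2 * n)" "mat_rank R = n - p"
    and QR: "qr_factorization N (Q1 @\<^sub>c Q2) R p"
  shows "unitary (Q1 @\<^sub>c Q2)" and "mat_adjoint (Q1 @\<^sub>c Q2) * N = R @\<^sub>r 0\<^sub>m p (2 * n)"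
    and "vec_space.col_space n Q2 = mat_kernel (P i\<omega>)" and "col_span Q2 = mat_kernel (P i\<omega>)"
proof -
  show U: "unitary (Q1 @\<^sub>c Q2)" and QN: "mat_adjoint (Q1 @\<^sub>c Q2) * N = R @\<^sub>r 0\<^sub>m p (2 * n)"
    using QR N_carrier by (auto simp: qr_factorization_def)
  have "vec_space.rank (n - p) R = n - p" using R by auto
  from col_space_eq_kernel[OF p Q U R(1) this QN]
  show "vec_space.col_space n Q2 = mat_kernel (P i\<omega>)" .
  then show "col_span Q2 = mat_kernel (P i\<omega>)"
    using Q(2) by (auto simp: vec_space.col_space_def)
qed

lemma deflation:
  assumes eig: "i\<omega> \<in> \<Lambda> P" and p: "p \<le> n" and rank: "mat_rank N = n - p"
    and Q: "Q1 \<in> carrier_mat n (n - p)" "Q2 \<in> carrier_mat n p"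
    and R: "R \<in> carrier_mat (n - p) (2 * n)" "mat_rank R = n - p"
    and QR: "qr_factorization N (Q1 @\<^sub>c Q2) R p"
  defines "X2 \<equiv> Q2 * inv_pd_sqrt (mat_adjoint Q2 * M * Q2)"
  assumes Y: "Y1 \<in> carrier_mat n p" "Y2 \<in> carrier_mat n (n - p)"
    and R1: "R1 \<in> carrier_mat p p"
    and QR1: "qr_factorization (M * X2) (Y1 @\<^sub>c Y2) R1 (n - p)"
  defines "X1 \<equiv> Y2 * inv_pd_sqrt (mat_adjoint Y2 * M * Y2)"
  defines "X \<equiv> X1 @\<^sub>c X2" and "Pt \<equiv> \<lambda>z. mat_adjoint X1 * P z * X1"
  shows "unitary_wrt M X"
    and "mat_adjoint X * P z * X = diag_block_mat [Pt z, (z\<^sup>2 + (complex_of_real \<omega>)\<^sup>2) \<cdot>\<^sub>m 1\<^sub>m p]"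
    and "regular Pt"
    and "\<Lambda> Pt = \<Lambda> P - {i\<omega>, - i\<omega>}"
proof -
  have np: "n - p + p = n" "p + (n - p) = n" using p by auto
  \<comment> \<open>An eigenvalue forces the rank n - p of \<open>N\<close> below n.\<close>
  have p0: "p \<noteq> 0" using eig rank eigenvalue_iff_rank rank_N by (auto simp: spectrum_of_def)
  note UQ = qr_factorization_N[OF p Q R QR]
  note span = UQ(3)
  note mo2 = M_orthonormalization[OF M Q(2) unitary_append_cols(2)[OF Q np(1) UQ(1)] meta_eq_to_obj_eq[OF X2_def]]
  have MX2: "M * X2 \<in> carrier_mat n p" using M(1) mo2(1) by simp
  have UY: "unitary (Y1 @\<^sub>c Y2)" and YM: "mat_adjoint (Y1 @\<^sub>c Y2) * (M * X2) = R1 @\<^sub>r 0\<^sub>m (n - p) p"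
    using QR1 MX2 by (auto simp: qr_factorization_def)
  note mo1 = M_orthonormalization[OF M Y(2) unitary_append_cols(2)[OF Y np(2) UY] meta_eq_to_obj_eq[OF X1_def]]
  \<comment> \<open>The zero block of the second factorization concerns \<open>Y2\<close>; the right
    factor \<open>T1\<close> carries the orthogonality over to \<open>X1\<close>.\<close>
  obtain T1 where T1: "T1 \<in> carrier_mat (n - p) (n - p)" "X1 = Y2 * T1" using mo1(3) by blast
  have "mat_adjoint Y2 * (M * X2) = 0\<^sub>m (n - p) p"
    using unitary_append_cols_mult_eq(2)[OF Y np(2) MX2 R1 YM] .
  moreover have "mat_adjoint X1 * M * X2 = mat_adjoint T1 * (mat_adjoint Y2 * (M * X2))"
    using T1 Y(2) M(1) mo2(1) by (auto simp: mat_adjoint_mult assoc_mult_mat_dim)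
  ultimately have orth: "mat_adjoint X1 * M * X2 = 0\<^sub>m (n - p) p"
    using T1 by simp
  obtain T2 where T2: "T2 \<in> carrier_mat p p" "X2 = Q2 * T2" using mo2(3) by blast
  note kerQ = mult_by_kernel[OF Q(2) unitary_append_cols_mult_eq(2)[OF Q np(1) N_carrier R(1) UQ(2)]]
  have ker: "P0 i\<omega> * X2 = 0\<^sub>m n p" "D * X2 = 0\<^sub>m n p"
    unfolding T2(2) assoc_mult_mat[OF P0_carrier Q(2) T2(1), symmetric]
      assoc_mult_mat[OF D(1) Q(2) T2(1), symmetric] kerQ
    using T2(1) by simp_all
  \<comment> \<open>Here the converse direction counts: \<open>Q2\<close> spans the kernel, and its
    columns are combinations of those of \<open>X2\<close>, so the range of \<open>X2\<close> is
    large enough.\<close>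
  obtain S2 where S2: "S2 \<in> carrier_mat p p" "Q2 = X2 * S2" using mo2(4) by blast
  have range: "\<exists>x \<in> carrier_vec p. v = X2 *\<^sub>v x" if v: "v \<in> mat_kernel (P i\<omega>)" for v
  proof -
    obtain y where "y \<in> carrier_vec p" "v = Q2 *\<^sub>v y"
      using v Q(2) unfolding span[symmetric] vec_space.col_space_eq[OF Q(2)] by auto
    then have "v = X2 *\<^sub>v (S2 *\<^sub>v y)" "S2 *\<^sub>v y \<in> carrier_vec p"
      using assoc_mult_mat_vec[OF mo2(1) S2(1)] S2 by auto
    then show ?thesis by blast
  qed
  note hyps = mo1(1,2) mo2(1,2) orth ker
  note block = block_diagonalization[OF p hyps, folded X_def]
  have "X \<in> carrier_mat n n"
    using append_cols_carrier[OF mo1(1) mo2(1)] np by (simp add: X_def)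
  then show "unitary_wrt M X" using M(1) block(1) by (auto simp: unitary_wrt_def)
  have "dim_row (Pt z) = n - p" "dim_col (Pt z) = n - p"
    using mo1(1) by (auto simp: Pt_def)
  then show "mat_adjoint X * P z * X = diag_block_mat [Pt z, (z\<^sup>2 + (complex_of_real \<omega>)\<^sup>2) \<cdot>\<^sub>m 1\<^sub>m p]"
    unfolding diag_block_mat_pair using block(2)[of z] by (simp add: Pt_def)
  have det: "det (P z) = 0 \<longleftrightarrow> det (Pt z) = 0 \<or> z = i\<omega> \<or> z = - i\<omega>" for z
    using det_P_eq_0_iff[OF p p0 hyps] by (simp add: Pt_def)
  \<comment> \<open>This includes p = n, where \<open>Pt\<close> is the empty matrix with
    determinant 1.\<close>
  then show "regular Pt" using regular_P by (auto simp: regular_def)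
  have "det (Pt z) \<noteq> 0" if "z = i\<omega> \<or> z = - i\<omega>" for z
    using deflated_det_nonzero[OF p hyps range that] by (simp add: Pt_def)
  then show "\<Lambda> Pt = \<Lambda> P - {i\<omega>, - i\<omega>}"
    using det by (auto simp: spectrum_of_def)
qed

end

theorem theorem27:
  fixes n :: nat and M D K :: "complex mat" and \<omega> :: real
    and P P0 :: "complex \<Rightarrow> complex mat" and i\<omega> :: complex
  assumes M: "M \<in> carrier_mat n n" "pos_def M"
    and D: "D \<in> carrier_mat n n" "pos_semidef D"
    and K: "K \<in> carrier_mat n n" "pos_semidef K"
    and P: "P = (\<lambda>z. z\<^sup>2 \<cdot>\<^sub>m M + z \<cdot>\<^sub>m D + K)"
    and P0: "P0 = (\<lambda>z. z\<^sup>2 \<cdot>\<^sub>m M + K)"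
    and \<omega>: "\<omega> \<noteq> 0"
    and i\<omega>: "i\<omega> = \<i> * complex_of_real \<omega>"
  shows "regular P \<and> regular P0 \<and>
    (i\<omega> \<in> \<Lambda> P \<longleftrightarrow> mat_rank (P0 i\<omega> @\<^sub>c D) < n) \<and>
    (i\<omega> \<in> \<Lambda> P \<longrightarrow>
       i\<omega> \<in> \<Lambda> P0 \<and> mat_kernel (P i\<omega>) = mat_kernel (P0 i\<omega>) \<inter> mat_kernel D) \<and>
    (\<forall>p. i\<omega> \<in> \<Lambda> P \<and> p \<le> n \<and> mat_rank (P0 i\<omega> @\<^sub>c D) = n - p \<longrightarrow>
       geom_mult P i\<omega> = p \<and>
       (\<forall>Q1 Q2 R.
          Q1 \<in> carrier_mat n (n - p) \<and> Q2 \<in> carrier_mat n p \<and>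
          R \<in> carrier_mat (n - p) (2 * n) \<and> mat_rank R = n - p \<and>
          qr_factorization (P0 i\<omega> @\<^sub>c D) (Q1 @\<^sub>c Q2) R p \<longrightarrow>
          col_span Q2 = mat_kernel (P i\<omega>) \<and>
          (let X2 = Q2 * inv_pd_sqrt (mat_adjoint Q2 * M * Q2) in
           \<forall>Y1 Y2 R1.
             Y1 \<in> carrier_mat n p \<and> Y2 \<in> carrier_mat n (n - p) \<and>
             R1 \<in> carrier_mat p p \<and>
             qr_factorization (M * X2) (Y1 @\<^sub>c Y2) R1 (n - p) \<longrightarrow>
             (let X1 = Y2 * inv_pd_sqrt (mat_adjoint Y2 * M * Y2);
                  X = X1 @\<^sub>c X2;
                  Pt = (\<lambda>z. mat_adjoint X1 * P z * X1)
              in unitary_wrt M X \<and>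
                 (\<forall>z. mat_adjoint X * P z * X
                      = diag_block_mat [Pt z, (z\<^sup>2 + (complex_of_real \<omega>)\<^sup>2) \<cdot>\<^sub>m 1\<^sub>m p]) \<and>
                 regular Pt \<and> \<Lambda> Pt = \<Lambda> P - {i\<omega>, - i\<omega>}))))"
proof -
  interpret S: damped_system n M D K \<omega>
    using M D K \<omega> by unfold_locales
  have P_eq: "P = S.P" and P0_eq: "P0 = S.P0" and i\<omega>_eq: "i\<omega> = S.i\<omega>"
    by (auto simp: P P0 i\<omega> S.P_def S.P0_def S.i\<omega>_def)
  show ?thesis
    unfolding Let_def P_eq P0_eq i\<omega>_eq S.N_def[symmetric]
  proof (intro conjI allI impI; (elim conjE)?)
    show "regular S.P" "regular S.P0" by (fact S.regular_P S.regular_P0)+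
    show "S.i\<omega> \<in> \<Lambda> S.P \<longleftrightarrow> mat_rank S.N < n"
      using S.eigenvalue_iff_rank by (simp add: spectrum_of_def S.rank_N)
    show "S.i\<omega> \<in> \<Lambda> S.P0" if "S.i\<omega> \<in> \<Lambda> S.P"
      using that S.eigenvalue_imp_undamped by (simp add: spectrum_of_def)
    show "mat_kernel (S.P S.i\<omega>) = mat_kernel (S.P0 S.i\<omega>) \<inter> mat_kernel D" by (fact S.P_kernel)
  \<comment> \<open>The goals left are the conjuncts under the quantifier over p; the hypotheses
    split off by \<open>conjE\<close> match the premises of the locale facts.\<close>
  qed (rule S.geom_mult_eq S.qr_factorization_N(4) S.deflation; assumption)+
qed

end
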